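(* Let $d\geq 3$ and let $\mathcal{F}_d=V(x^d+y^d+z^d)\subset\mathbb{P}^2$ be the Fermat curve of degree $d$ over $\mathbb{C}$. Let $p=(p_x:p_y:p_z)\in\mathcal{F}_d$. Then the osculating conic $O_p$ to $\mathcal{F}_d$ at $p$ is the zero set of the polynomial \begin{align*} &p_x^{2d-2}(d+1)\left((2d-1)p_y^dp_z^d+(2-d)(p_y^d+p_z^d)p_x^d\right)x^2\\ &+p_y^{2d-2}(d+1)\left((2d-1)p_x^dp_z^d+(2-d)(p_x^d+p_z^d)p_y^d\right)y^2\\ &+p_z^{2d-2}(d+1)\left((2d-1)p_x^dp_y^d+(2-d)(p_x^d+p_y^d)p_z^d\right)z^2\\ &-\left(2(d+1)(d-2)p_x^{2d-1}p_y^{2d-1}+4(2d-1)(d-2)(p_x^{d-1}p_y^{2d-1}+p_x^{2d-1}p_y^{d-1})p_z^d\right)xy\\ &-\left(2(d+1)(d-2)p_x^{2d-1}p_z^{2d-1}+4(2d-1)(d-2)(p_x^{d-1}p_z^{2d-1}+p_x^{2d-1}p_z^{d-1})p_y^d\right)xz\\ &-\left(2(d+1)(d-2)p_y^{2d-1}p_z^{2d-1}+4(2d-1)(d-2)(p_y^{d-1}p_z^{2d-1}+p_y^{2d-1}p_z^{d-1})p_x^d\right)yz. \end{align*}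
   Context: The osculating conic $O_p$ to $\mathcal{F}_d$ at a point $p$ is the unique conic (curve of degree $2$, possibly degenerate) whose intersection multiplicity with $\mathcal{F}_d$ at $p$ satisfies $(O_p.\mathcal{F}_d)_p\geq 5$.
   Formalization: For d ≥ 4 and p_x p_y p_z = 0 the conic with multiplicity ≥ 5 is not unique (tangent times any line through p also qualifies); there O_p is taken to be the unique conic of highest intersection multiplicity with F_d at p. *)

theory Defs
  imports
    Complex_Main
    "HOL-Library.Extended_Nat"
    "HOL-Computational_Algebra.Computational_Algebra"
begin

text \<open>
  The polynomial ring in \<open>x, y, z\<close> over the complex numbers is the iterated polynomial ring
  \<open>\<complex>[x][y][z]\<close>: the outermost variable is \<open>z\<close>, the innermost one is \<open>x\<close>.
  Points of the projective plane are given by homogeneous coordinate vectors different from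
  \<open>(0, 0, 0)\<close>; all notions below are invariant under rescaling these vectors.
\<close>

type_synonym tripoly = "complex poly poly poly"
type_synonym coords = "complex \<times> complex \<times> complex"

definition cst :: "complex \<Rightarrow> tripoly" where "cst c = [:[:[:c:]:]:]"
definition xvar :: tripoly where "xvar = [:[:[:0, 1:]:]:]"
definition yvar :: tripoly where "yvar = [:[:0, 1:]:]"
definition zvar :: tripoly where "zvar = [:0, 1:]"

definition eval3 :: "tripoly \<Rightarrow> coords \<Rightarrow> complex" where
  "eval3 P = (\<lambda>(x, y, z). poly (poly (poly P [:[:z:]:]) [:y:]) x)"

definition homogeneous :: "nat \<Rightarrow> tripoly \<Rightarrow> bool" where
  "homogeneous n P \<longleftrightarrow>
     (\<forall>i j k. coeff (coeff (coeff P k) j) i \<noteq> 0 \<longrightarrow> i + j + k = n)"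

definition zero_set :: "tripoly \<Rightarrow> coords set" where
  "zero_set P = {p. p \<noteq> (0, 0, 0) \<and> eval3 P p = 0}"

text \<open>
  The local ring of the projective plane at \<open>p\<close>, inside the fraction field of \<open>\<complex>[x, y, z]\<close>:
  quotients of forms of equal degree whose denominator does not vanish at \<open>p\<close>.
\<close>

definition local_ring :: "coords \<Rightarrow> tripoly fract set" where
  "local_ring p =
     {Fract G H | G H n. homogeneous n G \<and> homogeneous n H \<and> eval3 H p \<noteq> 0}"

text \<open>
  A form \<open>F\<close> has no value in the local ring; its dehomogenizations at \<open>p\<close> are the
  elements \<open>F / H\<close>, with \<open>H\<close> a form of the same degree and \<open>H(p) \<noteq> 0\<close>. They differ
  from each other by units of the local ring and hence generate the same ideal.
\<close>

definition local_equations :: "coords \<Rightarrow> tripoly \<Rightarrow> tripoly fract set" where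
  "local_equations p F =
     {Fract F H | H n. homogeneous n F \<and> homogeneous n H \<and> eval3 H p \<noteq> 0}"

definition local_ideal :: "coords \<Rightarrow> tripoly \<Rightarrow> tripoly \<Rightarrow> tripoly fract set" where
  "local_ideal p F G =
     {u * f + v * g | u v f g.
        u \<in> local_ring p \<and> v \<in> local_ring p \<and>
        f \<in> local_equations p F \<and> g \<in> local_equations p G}"

definition independent_mod :: "tripoly fract set \<Rightarrow> tripoly fract set \<Rightarrow> bool" where
  "independent_mod I B \<longleftrightarrow>
     (\<forall>a :: tripoly fract \<Rightarrow> complex.
        (\<Sum>b\<in>B. Fract (cst (a b)) 1 * b) \<in> I \<longrightarrow> (\<forall>b\<in>B. a b = 0))"

definition quotient_dim :: "tripoly fract set \<Rightarrow> tripoly fract set \<Rightarrow> enat" where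
  "quotient_dim V I =
     Sup {enat (card B) | B. finite B \<and> B \<subseteq> V \<and> independent_mod I B}"

text \<open>The intersection multiplicity at \<open>p\<close> of the curves \<open>F = 0\<close> and \<open>G = 0\<close> is the complex
  dimension of the local ring modulo the ideal generated by the two curves.\<close>

definition intersection_mult :: "coords \<Rightarrow> tripoly \<Rightarrow> tripoly \<Rightarrow> enat" where
  "intersection_mult p F G = quotient_dim (local_ring p) (local_ideal p F G)"

definition is_conic :: "tripoly \<Rightarrow> bool" where
  "is_conic C \<longleftrightarrow> homogeneous 2 C \<and> C \<noteq> 0"

definition same_curve :: "tripoly \<Rightarrow> tripoly \<Rightarrow> bool" where
  "same_curve C D \<longleftrightarrow> (\<exists>c. c \<noteq> 0 \<and> D = cst c * C)"

definition fermat_curve :: "nat \<Rightarrow> tripoly" where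
  "fermat_curve d = xvar ^ d + yvar ^ d + zvar ^ d"

text \<open>\<open>C\<close> is an equation of \<^emph>\<open>the unique\<close> conic meeting the Fermat curve at \<open>p\<close> with
  multiplicity at least 5.\<close>

definition is_osculating_conic :: "nat \<Rightarrow> coords \<Rightarrow> tripoly \<Rightarrow> bool" where
  "is_osculating_conic d p C \<longleftrightarrow>
     is_conic C \<and> 5 \<le> intersection_mult p C (fermat_curve d) \<and>
     (\<forall>D. is_conic D \<and> 5 \<le> intersection_mult p D (fermat_curve d) \<longrightarrow> same_curve C D)"

text \<open>
  At a flex of the Fermat curve (\<open>p\<^sub>x p\<^sub>y p\<^sub>z = 0\<close>) with \<open>d \<ge> 4\<close> the tangent line meets the
  curve with multiplicity \<open>d\<close>, so the union of the tangent with \<^emph>\<open>any\<close> line through \<open>p\<close> is a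
  conic of multiplicity at least \<open>d + 1 \<ge> 5\<close>, and no conic satisfies
  \<open>is_osculating_conic\<close>. There, the osculating conic can only be understood as the
  unique one among these conics that has the highest multiplicity.
\<close>

definition is_hyperosculating_conic :: "nat \<Rightarrow> coords \<Rightarrow> tripoly \<Rightarrow> bool" where
  "is_hyperosculating_conic d p C \<longleftrightarrow>
     is_conic C \<and> 5 \<le> intersection_mult p C (fermat_curve d) \<and>
     (\<forall>D. is_conic D \<and> 5 \<le> intersection_mult p D (fermat_curve d) \<and> \<not> same_curve C D \<longrightarrow>
        intersection_mult p D (fermat_curve d) < intersection_mult p C (fermat_curve d))"

definition osculating_poly :: "nat \<Rightarrow> coords \<Rightarrow> tripoly" where
  "osculating_poly d = (\<lambda>(px, py, pz).
      cst (px^(2*d-2) * (of_nat d + 1) *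
           ((2 * of_nat d - 1) * py^d * pz^d + (2 - of_nat d) * (py^d + pz^d) * px^d)) * xvar^2
    + cst (py^(2*d-2) * (of_nat d + 1) *
           ((2 * of_nat d - 1) * px^d * pz^d + (2 - of_nat d) * (px^d + pz^d) * py^d)) * yvar^2
    + cst (pz^(2*d-2) * (of_nat d + 1) *
           ((2 * of_nat d - 1) * px^d * py^d + (2 - of_nat d) * (px^d + py^d) * pz^d)) * zvar^2
    - cst (2 * (of_nat d + 1) * (of_nat d - 2) * px^(2*d-1) * py^(2*d-1)
           + 4 * (2 * of_nat d - 1) * (of_nat d - 2)
             * (px^(d-1) * py^(2*d-1) + px^(2*d-1) * py^(d-1)) * pz^d) * xvar * yvar
    - cst (2 * (of_nat d + 1) * (of_nat d - 2) * px^(2*d-1) * pz^(2*d-1)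
           + 4 * (2 * of_nat d - 1) * (of_nat d - 2)
             * (px^(d-1) * pz^(2*d-1) + px^(2*d-1) * pz^(d-1)) * py^d) * xvar * zvar
    - cst (2 * (of_nat d + 1) * (of_nat d - 2) * py^(2*d-1) * pz^(2*d-1)
           + 4 * (2 * of_nat d - 1) * (of_nat d - 2)
             * (py^(d-1) * pz^(2*d-1) + py^(2*d-1) * pz^(d-1)) * px^d) * yvar * zvar)"

end

(*
  Idea. A smooth point p of F = 0 is parametrized by a formal arc (x, y, z), and evaluation along
  the arc is a homomorphism from the local ring at p to the power series that kills F. Modulo F the
  maximal ideal of the local ring is generated by a single element tau of order one along the arc,
  so the intersection multiplicity of C and F is the order of C along the arc. On the Fermat curve
  one homogeneous coordinate of the arc is constant, a second one is linear in the parameter, and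
  the third one is a d-th root q. If p_x p_y p_z is nonzero, a differential equation for q gives its
  Taylor coefficients up to order 4, and comparing coefficients shows that the given conic has
  order at least 5 and is the only one. If one coordinate of p vanishes, q is constant up to order
  d, the given conic is a multiple of the squared tangent, and it has order at least 2d, whereas
  every other conic has order at most d + 1.
*)
theory Submission
  imports Defs
begin

section \<open>Evaluation of polynomials in three variables\<close>

text \<open>Two obstacles shape the argument. The multiplicity is a dimension of an abstract
  quotient, so orders of power series say something about it only once the local ring modulo the
  curve is known to have a uniformizer. This comes from factoring differences of \<open>d\<close>-th
  powers in the affine equation: the cofactor of \<open>q - q(p)\<close> is a unit exactly because
  the corresponding coordinate of \<open>p\<close> is nonzero. The degree \<open>d\<close> is a
  variable, so the branch cannot be expanded term by term. The differential equation turns the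
  exponent \<open>d\<close> into a coefficient. Weighting the \<open>i\<close>-th Taylor coefficient
  by \<open>p3 ^ i\<close> and the conic by the coordinates of \<open>p\<close> leaves only
  \<open>d\<close>-th powers of coordinates, which by the Fermat equation are
  \<open>(t - 1) * B\<close>, \<open>B\<close> and \<open>- t * B\<close>. The order of the stated
  conic thus rests on polynomial identities in \<open>t\<close> and \<open>d\<close>. Uniqueness
  compares five linear conditions with six coefficients. A sixth condition, the vanishing of one
  partial derivative at \<open>p\<close>, makes the system triangular, with the second Taylor
  coefficient of the branch as pivot; it is nonzero away from the flexes.\<close>

definition is_hom :: "('a::comm_ring_1 \<Rightarrow> 'b::comm_ring_1) \<Rightarrow> bool" where
  "is_hom h \<longleftrightarrow> h 0 = 0 \<and> h 1 = 1 \<and> (\<forall>a b. h (a + b) = h a + h b) \<and> (\<forall>a b. h (a * b) = h a * h b)"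

lemma is_homD:
  assumes "is_hom h"
  shows "h 0 = 0" "h 1 = 1" "h (a + b) = h a + h b" "h (a * b) = h a * h b"
    "h (- a) = - h a" "h (a - b) = h a - h b" "h (a ^ n) = h a ^ n"
    "h (sum f A) = (\<Sum>i\<in>A. h (f i))" "h (of_nat n) = of_nat n"
proof -
  show *: "h 0 = 0" "h 1 = 1" "\<And>a b. h (a + b) = h a + h b" "\<And>a b. h (a * b) = h a * h b"
    using assms by (auto simp: is_hom_def)
  have neg: "h (- a) = - h a" for a
    using *(3)[of a "- a"] *(1) by (simp add: add_eq_0_iff)
  show "h (- a) = - h a" by (rule neg)
  show "h (a - b) = h a - h b"
    using *(3)[of a "- b"] by (simp add: neg)
  show "h (a ^ n) = h a ^ n"
    by (induction n) (simp_all add: *)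
  show "h (sum f A) = (\<Sum>i\<in>A. h (f i))"
    by (induction A rule: infinite_finite_induct) (simp_all add: *)
  show "h (of_nat n) = of_nat n"
    by (induction n) (simp_all add: *)
qed

definition lift :: "('a::comm_ring_1 \<Rightarrow> 'b::comm_ring_1) \<Rightarrow> 'b \<Rightarrow> 'a poly \<Rightarrow> 'b" where
  "lift h X p = poly (map_poly h p) X"

lemma lift_0 [simp]: "lift h X 0 = 0"
  by (simp add: lift_def)

lemma lift_pCons: "is_hom h \<Longrightarrow> lift h X (pCons a p) = h a + X * lift h X p"
  by (simp add: lift_def map_poly_pCons is_homD(1))

lemma is_hom_lift:
  assumes h: "is_hom h"
  shows "is_hom (lift h X)"
proof -
  have add: "lift h X (p + q) = lift h X p + lift h X q" for p q
    by (induction p q rule: poly_induct2) (simp_all add: lift_pCons[OF h] is_homD[OF h] algebra_simps)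
  have smult: "lift h X (smult a q) = h a * lift h X q" for a q
    by (induction q) (simp_all add: lift_pCons[OF h] is_homD[OF h] algebra_simps)
  have "lift h X (p * q) = lift h X p * lift h X q" for p q
    by (induction p) (simp_all add: lift_pCons[OF h] add smult is_homD(1)[OF h] algebra_simps)
  moreover have "lift h X 1 = 1"
    unfolding one_pCons by (simp add: lift_pCons[OF h] is_homD[OF h])
  ultimately show ?thesis
    by (simp add: is_hom_def add)
qed

lemma lift_altdef:
  assumes "is_hom h"
  shows "lift h X p = (\<Sum>i\<le>degree p. h (coeff p i) * X ^ i)"
proof -
  have "lift h X p = (\<Sum>i\<le>degree p. coeff (map_poly h p) i * X ^ i)"
    unfolding lift_def poly_altdef
    by (intro sum.mono_neutral_left) (auto simp: map_poly_degree_leq coeff_eq_0)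
  then show ?thesis
    by (simp add: coeff_map_poly is_homD(1)[OF assms])
qed

definition ev :: "(complex \<Rightarrow> 'b::comm_ring_1) \<Rightarrow> 'b \<Rightarrow> 'b \<Rightarrow> 'b \<Rightarrow> tripoly \<Rightarrow> 'b" where
  "ev h X Y Z = lift (lift (lift h X) Y) Z"

lemma is_hom_ev: "is_hom h \<Longrightarrow> is_hom (ev h X Y Z)"
  by (simp add: ev_def is_hom_lift)

lemma ev_simps [simp]:
  assumes "is_hom h"
  shows "ev h X Y Z (cst c) = h c" "ev h X Y Z xvar = X" "ev h X Y Z yvar = Y" "ev h X Y Z zvar = Z"
  using assms
  by (simp_all add: ev_def cst_def xvar_def yvar_def zvar_def lift_pCons is_hom_lift is_homD
      pCons_one)

text \<open>The rule follows the ring operations instead of the nested coefficient lists, so that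
  equalities of homomorphisms, or congruences between them, need checking on constants and variables
  only.\<close>

lemma tripoly_induct [case_names cst add x y z]:
  fixes P :: "tripoly \<Rightarrow> bool"
  assumes c: "\<And>c. P (cst c)" and add: "\<And>p q. P p \<Longrightarrow> P q \<Longrightarrow> P (p + q)"
    and x: "\<And>p. P p \<Longrightarrow> P (xvar * p)" and y: "\<And>p. P p \<Longrightarrow> P (yvar * p)"
    and z: "\<And>p. P p \<Longrightarrow> P (zvar * p)"
  shows "P p"
proof -
  have P0: "P 0" using c[of 0] by (simp add: cst_def)
  have 1: "P [:[:a:]:]" for a
  proof (induction a)
    case (pCons b a)
    have "[:[:pCons b a:]:] = cst b + xvar * [:[:a:]:]"
      by (simp add: cst_def xvar_def)
    then show ?case using pCons c x add by metis
  qed (simp add: P0)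
  have 2: "P [:a:]" for a
  proof (induction a)
    case (pCons b a)
    have "[:pCons b a:] = [:[:b:]:] + yvar * [:a:]"
      by (simp add: yvar_def)
    then show ?case using pCons 1 y add by metis
  qed (simp add: P0)
  show ?thesis
  proof (induction p)
    case (pCons b a)
    have "pCons b a = [:b:] + zvar * a"
      by (simp add: zvar_def)
    then show ?case using pCons 2 z add by metis
  qed (simp add: P0)
qed

lemma hom_ext:
  fixes f g :: "tripoly \<Rightarrow> 'b::comm_ring_1"
  assumes f: "is_hom f" and g: "is_hom g"
    and "\<And>c. f (cst c) = g (cst c)" "f xvar = g xvar" "f yvar = g yvar" "f zvar = g zvar"
  shows "f P = g P"
  by (induction P rule: tripoly_induct) (simp_all add: is_homD[OF f] is_homD[OF g] assms)

lemma is_hom_eval3: "is_hom (\<lambda>P. eval3 P p)"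
  by (cases p) (simp add: is_hom_def eval3_def)

lemmas eval3_hom = is_homD[OF is_hom_eval3]

lemma eval3_simps [simp]:
  "eval3 (cst c) (x, y, z) = c" "eval3 xvar (x, y, z) = x" "eval3 yvar (x, y, z) = y"
  "eval3 zvar (x, y, z) = z"
  by (simp_all add: eval3_def cst_def xvar_def yvar_def zvar_def)

lemma is_hom_id: "is_hom id"
  by (simp add: is_hom_def)

lemma eval3_eq_ev: "eval3 P (x, y, z) = ev id x y z P"
  by (rule hom_ext[OF is_hom_eval3 is_hom_ev[OF is_hom_id]]) (simp_all add: is_hom_id)

text \<open>A monomial scales by \<open>l ^ (i + j + k)\<close>. The scale may lie in any target
  ring: with the linear form \<open>N\<close> in the fraction field as \<open>l\<close>, this is
  dehomogenization.\<close>

lemma ev_homogeneous: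
  assumes h: "is_hom h" and P: "homogeneous n P"
  shows "ev h (l * X) (l * Y) (l * Z) P = l ^ n * ev h X Y Z P"
proof -
  have ev: "ev h X Y Z P = (\<Sum>k\<le>degree P. \<Sum>j\<le>degree (coeff P k). \<Sum>i\<le>degree (coeff (coeff P k) j).
     h (coeff (coeff (coeff P k) j) i) * X ^ i * Y ^ j * Z ^ k)" for X Y Z
    unfolding ev_def
    by (simp add: lift_altdef is_hom_lift h sum_distrib_right)
  have tm: "h (coeff (coeff (coeff P k) j) i) * (l * X) ^ i * (l * Y) ^ j * (l * Z) ^ k =
      l ^ n * (h (coeff (coeff (coeff P k) j) i) * X ^ i * Y ^ j * Z ^ k)" for i j k
  proof (cases "coeff (coeff (coeff P k) j) i = 0")
    case False
    with P have "n = i + j + k" by (auto simp: homogeneous_def)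
    then show ?thesis by (simp add: power_mult_distrib power_add algebra_simps)
  qed (simp add: is_homD[OF h])
  show ?thesis
    unfolding ev sum_distrib_left by (simp only: tm)
qed

section \<open>Homogeneous polynomials\<close>

lemma homogeneous_0 [simp]: "homogeneous n 0"
  by (simp add: homogeneous_def)

lemma homogeneous_cst [simp]: "homogeneous 0 (cst c)"
  by (auto simp: homogeneous_def cst_def coeff_pCons split: nat.splits)

lemma homogeneous_vars [simp]:
  "homogeneous (Suc 0) xvar" "homogeneous (Suc 0) yvar" "homogeneous (Suc 0) zvar"
  by (auto simp: homogeneous_def xvar_def yvar_def zvar_def coeff_pCons split: nat.splits if_splits)

lemma homogeneous_add: "homogeneous n P \<Longrightarrow> homogeneous n Q \<Longrightarrow> homogeneous n (P + Q)"
  unfolding homogeneous_def by (metis add.right_neutral coeff_add)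

lemma homogeneous_mult:
  assumes P: "homogeneous m P" and Q: "homogeneous n Q"
  shows "homogeneous (m + n) (P * Q)"
  unfolding homogeneous_def
proof (intro allI impI)
  fix i j k
  assume nz: "coeff (coeff (coeff (P * Q) k) j) i \<noteq> 0"
  \<comment> \<open>A threefold convolution; a nonzero sum has a nonzero summand, and both factors
    of that summand are nonzero.\<close>
  have "coeff (coeff (coeff (P * Q) k) j) i = (\<Sum>c\<le>k. \<Sum>b\<le>j. \<Sum>a\<le>i.
      coeff (coeff (coeff P c) b) a * coeff (coeff (coeff Q (k - c)) (j - b)) (i - a))"
    by (simp add: coeff_mult coeff_sum)
  with nz obtain c where c: "c \<le> k" and "(\<Sum>b\<le>j. \<Sum>a\<le>i.
      coeff (coeff (coeff P c) b) a * coeff (coeff (coeff Q (k - c)) (j - b)) (i - a)) \<noteq> 0"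
    by (metis (no_types, lifting) atMost_iff sum.neutral)
  then obtain b where b: "b \<le> j" and "(\<Sum>a\<le>i.
      coeff (coeff (coeff P c) b) a * coeff (coeff (coeff Q (k - c)) (j - b)) (i - a)) \<noteq> 0"
    by (metis (no_types, lifting) atMost_iff sum.neutral)
  then obtain a where a: "a \<le> i" and
    "coeff (coeff (coeff P c) b) a * coeff (coeff (coeff Q (k - c)) (j - b)) (i - a) \<noteq> 0"
    by (metis (no_types, lifting) atMost_iff sum.neutral)
  then have "a + b + c = m" "(i - a) + (j - b) + (k - c) = n"
    using P Q unfolding homogeneous_def mult_eq_0_iff de_Morgan_disj by blast+
  with a b c show "i + j + k = m + n" by linarith
qed

lemma homogeneous_cst_mult: "homogeneous n P \<Longrightarrow> homogeneous n (cst c * P)"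
  using homogeneous_mult[OF homogeneous_cst] by simp

lemma homogeneous_power: "homogeneous m P \<Longrightarrow> homogeneous (m * n) (P ^ n)"
  by (induction n)
    (auto dest: homogeneous_mult simp: one_pCons cst_def[symmetric] simp flip: pCons_one)

lemma cst_arith: "cst 0 = 0" "cst 1 = 1" "cst (a + b) = cst a + cst b" "cst (a * b) = cst a * cst b"
  by (simp_all add: cst_def one_pCons)

lemma is_hom_cst: "is_hom cst"
  by (simp add: is_hom_def cst_arith)

lemmas cst_hom = is_homD[OF is_hom_cst]

lemma homogeneous_diff: "homogeneous n P \<Longrightarrow> homogeneous n Q \<Longrightarrow> homogeneous n (P - Q)"
  using homogeneous_add[of n P "cst (- 1) * Q"] homogeneous_cst_mult[of n Q "- 1"]
  by (simp add: cst_hom)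

section \<open>The local ring at a point\<close>

lemma is_hom_fract: "is_hom (\<lambda>P::tripoly. Fract P 1)"
  by (simp add: is_hom_def Zero_fract_def One_fract_def)

lemma is_hom_fract_cst: "is_hom (\<lambda>c. Fract (cst c) 1)"
  by (simp add: is_hom_def Zero_fract_def One_fract_def cst_hom)

lemma local_ringI:
  "homogeneous n G \<Longrightarrow> homogeneous n H \<Longrightarrow> eval3 H p \<noteq> 0 \<Longrightarrow> Fract G H \<in> local_ring p"
  by (auto simp: local_ring_def)

lemma local_ringE:
  assumes "g \<in> local_ring p"
  obtains G H n where "g = Fract G H" "homogeneous n G" "homogeneous n H" "eval3 H p \<noteq> 0" "H \<noteq> 0"
  using assms eval3_hom(1) unfolding local_ring_def by fastforce

lemma local_ring_const [simp]: "Fract (cst c) 1 \<in> local_ring p"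
  using local_ringI[OF homogeneous_cst homogeneous_cst, of 1 p c]
  by (simp add: cst_hom(2) eval3_hom(2))

lemma local_ring_0 [simp]: "0 \<in> local_ring p" and local_ring_1 [simp]: "1 \<in> local_ring p"
  using local_ring_const[of 0 p] local_ring_const[of 1 p]
  by (simp_all add: cst_hom Zero_fract_def One_fract_def)

lemma local_ring_mult [simp]:
  assumes "g \<in> local_ring p" "h \<in> local_ring p"
  shows "g * h \<in> local_ring p"
  using assms by (elim local_ringE) (auto intro!: local_ringI homogeneous_mult simp: eval3_hom)

lemma local_ring_add [simp]:
  assumes "g \<in> local_ring p" "h \<in> local_ring p"
  shows "g + h \<in> local_ring p"
proof -
  obtain G H n where g: "g = Fract G H" "homogeneous n G" "homogeneous n H" "eval3 H p \<noteq> 0" "H \<noteq> 0"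
    using assms(1) by (rule local_ringE)
  obtain G' H' m where h: "h = Fract G' H'" "homogeneous m G'" "homogeneous m H'" "eval3 H' p \<noteq> 0" "H' \<noteq> 0"
    using assms(2) by (rule local_ringE)
  have "homogeneous (n + m) (G * H' + G' * H)"
    using g h homogeneous_mult[of n G m H'] homogeneous_mult[of m G' n H]
    by (auto intro!: homogeneous_add simp: add.commute)
  then show ?thesis
    using g h by (auto intro!: local_ringI[of "n + m"] homogeneous_mult simp: eval3_hom)
qed

lemma local_ring_uminus [simp]: "g \<in> local_ring p \<Longrightarrow> - g \<in> local_ring p"
  using local_ring_mult[OF local_ring_const[of "- 1" p], of g] by (simp add: is_homD[OF is_hom_fract_cst] del: local_ring_mult)

lemma local_ring_diff [simp]: "g \<in> local_ring p \<Longrightarrow> h \<in> local_ring p \<Longrightarrow> g - h \<in> local_ring p"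
  using local_ring_add[of g p "- h"] by simp

lemma local_ring_power [simp]: "g \<in> local_ring p \<Longrightarrow> g ^ n \<in> local_ring p"
  by (induction n) auto

lemma local_ring_sum: "(\<And>i. i \<in> A \<Longrightarrow> f i \<in> local_ring p) \<Longrightarrow> sum f A \<in> local_ring p"
  by (induction A rule: infinite_finite_induct) auto

section \<open>A linear system with more unknowns than equations\<close>

text \<open>Gaussian elimination, one equation at a time. It will bound the number of elements
  independent modulo an ideal, the equations being the vanishing of the first \<open>m\<close>
  coefficients along the arc.\<close>

lemma nontrivial_solution:
  fixes f :: "'a \<Rightarrow> nat \<Rightarrow> 'b::field"
  assumes "finite B" "m < card B"
  shows "\<exists>a. (\<exists>b\<in>B. a b \<noteq> 0) \<and> (\<forall>i<m. (\<Sum>b\<in>B. a b * f b i) = 0)"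
  using assms
proof (induction m arbitrary: B f)
  case 0
  then show ?case by (intro exI[of _ "\<lambda>_. 1"]) (auto simp: card_gt_0_iff)
next
  case (Suc m)
  show ?case
  proof (cases "\<forall>b\<in>B. f b m = 0")
    case True
    obtain a where a: "\<exists>b\<in>B. a b \<noteq> 0" "\<forall>i<m. (\<Sum>b\<in>B. a b * f b i) = 0"
      using Suc.IH[of B f] Suc.prems by auto
    with True have "\<forall>i<Suc m. (\<Sum>b\<in>B. a b * f b i) = 0"
      by (auto simp: less_Suc_eq)
    with a show ?thesis by blast
  next
    case False
    then obtain c where c: "c \<in> B" "f c m \<noteq> 0" by blast
    define B' where "B' = B - {c}"
    define f' where "f' b i = f b i - f b m / f c m * f c i" for b i
    have B': "finite B'" "m < card B'" "c \<notin> B'" "B = insert c B'"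
      using Suc.prems c by (auto simp: B'_def)
    obtain a where a: "\<exists>b\<in>B'. a b \<noteq> 0" "\<forall>i<m. (\<Sum>b\<in>B'. a b * f' b i) = 0"
      using Suc.IH[of B' f'] B' by blast
    define s where "s = (\<Sum>b\<in>B'. a b * f b m)"
    \<comment> \<open>Back substitution: the value at the pivot \<open>c\<close> is the one that
      makes equation \<open>m\<close> hold.\<close>
    define a' where "a' b = (if b = c then - s / f c m else a b)" for b
    have *: "(\<Sum>b\<in>B. a' b * f b i) = (\<Sum>b\<in>B'. a b * f' b i)" for i
    proof -
      have "(\<Sum>b\<in>B. a' b * f b i) = - s / f c m * f c i + (\<Sum>b\<in>B'. a' b * f b i)"
        using B' by (simp add: a'_def)
      also have "(\<Sum>b\<in>B'. a' b * f b i) = (\<Sum>b\<in>B'. a b * f b i)"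
        using B' by (intro sum.cong) (auto simp: a'_def)
      also have "(\<Sum>b\<in>B'. a b * f' b i) = (\<Sum>b\<in>B'. a b * f b i) - s / f c m * f c i"
        by (simp add: f'_def s_def algebra_simps sum_subtractf sum_distrib_left sum_divide_distrib)
      ultimately show ?thesis by simp
    qed
    have "(\<Sum>b\<in>B'. a b * f' b m) = 0"
      using c by (simp add: f'_def)
    with a(2) have "\<forall>i<Suc m. (\<Sum>b\<in>B. a' b * f b i) = 0"
      by (auto simp: * less_Suc_eq)
    moreover have "\<exists>b\<in>B. a' b \<noteq> 0"
      using a(1) B' by (auto simp: a'_def)
    ultimately show ?thesis by blast
  qed
qed

section \<open>Intersection multiplicity along a smooth branch\<close>

lemma is_hom_fps_const: "is_hom fps_const"
  by (simp add: is_hom_def)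

section \<open>Values of the local ring along a formal arc\<close>

locale arc =
  fixes px py pz :: complex and x y z :: "complex fps" and p :: coords
    and E :: "tripoly \<Rightarrow> complex fps"
  defines "p \<equiv> (px, py, pz)" and "E \<equiv> ev fps_const x y z"
  assumes xyz: "x $ 0 = px" "y $ 0 = py" "z $ 0 = pz"
begin

lemma is_hom_E: "is_hom E"
  by (simp add: E_def is_hom_ev is_hom_fps_const)

lemmas E_hom = is_homD[OF is_hom_E]

lemma E_cst [simp]: "E (cst c) = fps_const c"
  by (simp add: E_def is_hom_fps_const)

lemma E_nth_0: "E P $ 0 = eval3 P p"
proof -
  have "is_hom (\<lambda>P. E P $ 0)"
    by (simp add: is_hom_def E_hom)
  then show ?thesis
    using is_hom_eval3 by (rule hom_ext) (simp_all add: E_def p_def xyz is_hom_fps_const)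
qed

lemma E_nz: "eval3 P p \<noteq> 0 \<Longrightarrow> E P \<noteq> 0"
  using E_nth_0[of P] by auto

lemma eval3_nz: "eval3 P p \<noteq> 0 \<Longrightarrow> P \<noteq> 0"
  by (metis eval3_hom(1))

text \<open>The value of a fraction along the arc. It does not depend on the representative, since
  power series form a domain and a denominator that is nonzero at \<open>p\<close> is nonzero along
  the arc.\<close>

definition phi :: "tripoly fract \<Rightarrow> complex fps" where
  "phi g = (THE s. \<exists>G H. g = Fract G H \<and> eval3 H p \<noteq> 0 \<and> E G = s * E H)"

lemma phi_Fract:
  assumes "eval3 H p \<noteq> 0"
  shows "phi (Fract G H) = E G * inverse (E H)"
  unfolding phi_def
proof (rule the_equality)
  have "inverse (E H) * E H = 1"
    using assms by (intro inverse_mult_eq_1) (simp add: E_nth_0)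
  then show "\<exists>G' H'. Fract G H = Fract G' H' \<and> eval3 H' p \<noteq> 0 \<and> E G' = E G * inverse (E H) * E H'"
    using assms by (intro exI[of _ G] exI[of _ H]) (simp add: mult.assoc)
  fix s
  assume "\<exists>G' H'. Fract G H = Fract G' H' \<and> eval3 H' p \<noteq> 0 \<and> E G' = s * E H'"
  then obtain G' H' where *: "Fract G H = Fract G' H'" "eval3 H' p \<noteq> 0" "E G' = s * E H'"
    by blast
  then have "G * H' = G' * H"
    using eval3_nz[of H] eval3_nz[of H'] assms by (simp add: eq_fract)
  then have "E G * E H' = s * E H' * E H"
    using * E_hom(4) by metis
  then have "E G = s * E H"
    using E_nz[OF *(2)] by simp
  then show "s = E G * inverse (E H)"
    using \<open>inverse (E H) * E H = 1\<close> by (simp add: ac_simps)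
qed

lemma phi_add:
  assumes "g \<in> local_ring p" "h \<in> local_ring p"
  shows "phi (g + h) = phi g + phi h"
proof -
  obtain G H n where g: "g = Fract G H" "eval3 H p \<noteq> 0" "H \<noteq> 0"
    using assms(1) by (rule local_ringE)
  obtain G' H' m where h: "h = Fract G' H'" "eval3 H' p \<noteq> 0" "H' \<noteq> 0"
    using assms(2) by (rule local_ringE)
  have "inverse (E H) * E H = 1" "inverse (E H') * E H' = 1"
    using g h by (auto intro!: inverse_mult_eq_1 simp: E_nth_0)
  then have "E (G * H' + G' * H) * inverse (E (H * H')) = E G * inverse (E H) + E G' * inverse (E H')"
    unfolding E_hom fps_inverse_mult by algebra
  then show ?thesis
    using g h by (simp add: phi_Fract eval3_hom)
qed

lemma phi_mult:
  assumes "g \<in> local_ring p" "h \<in> local_ring p"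
  shows "phi (g * h) = phi g * phi h"
  using assms
  by (elim local_ringE) (simp add: phi_Fract eval3_hom E_hom fps_inverse_mult)

lemma phi_const: "phi (Fract (cst c) 1) = fps_const c"
  by (simp add: phi_Fract eval3_hom(2) E_hom(2))

lemma phi_0 [simp]: "phi 0 = 0" and phi_1 [simp]: "phi 1 = 1"
  using phi_const[of 0] phi_const[of 1] by (simp_all add: cst_hom Zero_fract_def One_fract_def)

lemma phi_power: "g \<in> local_ring p \<Longrightarrow> phi (g ^ n) = phi g ^ n"
  by (induction n) (simp_all add: phi_mult)

lemma phi_sum: "(\<And>i. i \<in> A \<Longrightarrow> f i \<in> local_ring p) \<Longrightarrow> phi (sum f A) = (\<Sum>i\<in>A. phi (f i))"
  by (induction A rule: infinite_finite_induct) (auto simp: phi_add local_ring_sum)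

text \<open>The numerator of such an element does not vanish at \<open>p\<close>, so the reciprocal
  fraction is again in the local ring.\<close>

lemma local_ring_inverse:
  assumes "g \<in> local_ring p" "phi g $ 0 \<noteq> 0"
  shows "\<exists>h\<in>local_ring p. g * h = 1"
proof -
  obtain G H n where g: "g = Fract G H" "homogeneous n G" "homogeneous n H" "eval3 H p \<noteq> 0" "H \<noteq> 0"
    using assms(1) by (rule local_ringE)
  have G: "eval3 G p \<noteq> 0"
    using assms(2) g by (simp add: phi_Fract E_nth_0)
  have "Fract G H * Fract H G = 1"
    using g eval3_nz[OF G] by (simp add: One_fract_def eq_fract)
  with g G show ?thesis by (auto intro!: bexI[of _ "Fract H G"] local_ringI)
qed

end

text \<open>
  The assumptions on \<open>T / N\<close> say that it is a uniformizer of the curve \<open>F = 0\<close> at \<open>p\<close>: it vanishes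
  to order one along the arc and generates the maximal ideal of the local ring modulo \<open>F\<close>.
\<close>

locale branch = arc px py pz x y z p E
  for px py pz :: complex and x y z :: "complex fps" and p :: coords
    and E :: "tripoly \<Rightarrow> complex fps" +
  fixes F N T :: tripoly and d :: nat
  assumes hom_F: "homogeneous d F" and hom_N: "homogeneous 1 N" and hom_T: "homogeneous 1 T"
    and EF: "E F = 0" and Np: "eval3 N p \<noteq> 0" and T0: "E T $ 0 = 0" and T1: "E T $ 1 \<noteq> 0"
    and gen: "\<And>V. V \<in> {xvar, yvar, zvar} \<Longrightarrow> \<exists>u\<in>local_ring p. \<exists>v\<in>local_ring p.
       Fract V N - Fract (cst (eval3 V p / eval3 N p)) 1 = Fract T N * u + Fract F (N ^ d) * v"
begin

abbreviation "tau \<equiv> Fract T N"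
abbreviation "f \<equiv> Fract F (N ^ d)"

lemma power_N: "homogeneous n (N ^ n)" "eval3 (N ^ n) p \<noteq> 0"
  using homogeneous_power[OF hom_N, of n] Np by (simp_all add: eval3_hom)

lemma f_in [simp]: "f \<in> local_ring p" and tau_in [simp]: "tau \<in> local_ring p"
  using hom_F hom_N hom_T Np by (auto intro!: local_ringI simp: power_N)

lemma phi_f: "phi f = 0"
  by (simp add: phi_Fract power_N EF)

lemma phi_tau: "\<exists>s. phi tau = fps_X * s \<and> s $ 0 \<noteq> 0"
proof -
  let ?s = "fps_shift 1 (E T)"
  have "E T = fps_X * ?s"
    using T0 by (simp add: fps_eq_iff)
  then have "phi tau = fps_X * (?s * inverse (E N))"
    using Np by (simp add: phi_Fract mult.assoc)
  moreover have "(?s * inverse (E N)) $ 0 \<noteq> 0"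
    using T1 Np by (simp add: E_nth_0)
  ultimately show ?thesis by blast
qed

text \<open>Knowing the three coordinates suffices: evaluation at the quotients by \<open>N\<close>
  and evaluation at their values at \<open>p\<close> are homomorphisms that agree modulo
  \<open>J\<close> on the variables, hence everywhere. On a form \<open>G\<close> of degree
  \<open>k\<close> vanishing at \<open>p\<close>, the first gives \<open>G / N ^ k\<close> and the
  second 0.\<close>

lemma maximal_ideal:
  assumes "g \<in> local_ring p" "phi g $ 0 = 0"
  shows "\<exists>u\<in>local_ring p. \<exists>v\<in>local_ring p. g = tau * u + f * v"
proof -
  define J where "J = {tau * u + f * v | u v. u \<in> local_ring p \<and> v \<in> local_ring p}"
  have J_add: "a + b \<in> J" if ab: "a \<in> J" "b \<in> J" for a b
  proof -
    obtain u v u' v' where "u \<in> local_ring p" "v \<in> local_ring p" "u' \<in> local_ring p" "v' \<in> local_ring p"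
      "a = tau * u + f * v" "b = tau * u' + f * v'"
      using ab by (auto simp: J_def)
    then have "a + b = tau * (u + u') + f * (v + v')" "u + u' \<in> local_ring p" "v + v' \<in> local_ring p"
      by (simp_all add: algebra_simps)
    then show ?thesis unfolding J_def by blast
  qed
  have J_mult: "a * b \<in> J" if ab: "a \<in> J" "b \<in> local_ring p" for a b
  proof -
    obtain u v where "u \<in> local_ring p" "v \<in> local_ring p" "a = tau * u + f * v"
      using ab by (auto simp: J_def)
    then have "a * b = tau * (u * b) + f * (v * b)" "u * b \<in> local_ring p" "v * b \<in> local_ring p"
      using ab by (simp_all add: algebra_simps)
    then show ?thesis unfolding J_def by blast
  qed
  have J_0: "0 \<in> J"
    unfolding J_def by (auto intro!: exI[of _ 0])
  define h :: "complex \<Rightarrow> tripoly fract" where "h c = Fract (cst c) 1" for c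
  define n where "n = eval3 N p"
  have h: "is_hom h"
    unfolding h_def by (rule is_hom_fract_cst)
  define S where "S = ev h (Fract xvar N) (Fract yvar N) (Fract zvar N)"
  \<comment> \<open>Division by \<open>n\<close> picks the representative of \<open>p\<close> at
    which \<open>N\<close> has value 1, in accordance with \<open>S\<close>.\<close>
  define S0 where "S0 P = h (eval3 P (px / n, py / n, pz / n))" for P
  have S: "is_hom S"
    unfolding S_def using h by (rule is_hom_ev)
  have S0: "is_hom S0"
    unfolding is_hom_def S0_def by (simp add: eval3_hom is_homD[OF h])
  have vars: "Fract V N - S0 V \<in> J \<and> Fract V N \<in> local_ring p" if "V \<in> {xvar, yvar, zvar}" for V
  proof -
    have "eval3 V (px / n, py / n, pz / n) = eval3 V p / eval3 N p" "homogeneous 1 V"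
      using that by (auto simp: p_def n_def)
    moreover from this have "Fract V N \<in> local_ring p"
      using hom_N Np by (auto intro!: local_ringI)
    ultimately show ?thesis
      using gen[OF that] by (auto simp: S0_def h_def J_def)
  qed
  have S0_in: "S0 P \<in> local_ring p" for P
    by (simp add: S0_def h_def)
  have step: "S (V * P) - S0 (V * P) \<in> J" if "V \<in> {xvar, yvar, zvar}" "S P - S0 P \<in> J" for V P
  proof -
    \<comment> \<open>The product rule for differences; each summand has a factor in
      \<open>J\<close>.\<close>
    have "S (V * P) - S0 (V * P) = (S P - S0 P) * Fract V N + (Fract V N - S0 V) * S0 P"
    proof -
      have "S V = Fract V N"
        using that(1) h by (auto simp: S_def)
      then show ?thesis
        by (simp add: is_homD[OF S] is_homD[OF S0] algebra_simps)
    qed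
    then show ?thesis
      using vars[OF that(1)] that(2) J_add J_mult S0_in by simp
  qed
  have cong: "S P - S0 P \<in> J" for P
  proof (induction P rule: tripoly_induct)
    case (cst c)
    then show ?case
      using J_0 h by (simp add: S_def S0_def)
  next
    case (add P Q)
    then show ?case
      using J_add[OF add] by (simp add: is_homD[OF S] is_homD[OF S0] algebra_simps)
  qed (use step in auto)
  obtain G H k where g: "g = Fract G H" "homogeneous k G" "homogeneous k H" "eval3 H p \<noteq> 0" "H \<noteq> 0"
    using assms(1) by (rule local_ringE)
  have "E G $ 0 = 0"
    using assms(2) g by (simp add: phi_Fract E_nth_0)
  then have Gp: "eval3 G (px, py, pz) = 0"
    by (simp add: E_nth_0 p_def)
  have "eval3 G (px / n, py / n, pz / n) = (1 / n) ^ k * eval3 G (px, py, pz)"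
    using ev_homogeneous[OF is_hom_id g(2), of "1 / n" px py pz] by (simp add: eval3_eq_ev)
  then have "S0 G = 0"
    using Gp h by (simp add: S0_def is_homD)
  moreover have "S G = Fract G (N ^ k)"
  proof -
    have N: "N \<noteq> 0" using Np eval3_nz by blast
    have cancel: "Fract N 1 * Fract V N = Fract V 1" for V
      using N by (simp add: eq_fract)
    have "Fract G 1 = ev h (Fract xvar 1) (Fract yvar 1) (Fract zvar 1) G"
      by (rule hom_ext[OF is_hom_fract is_hom_ev[OF h]]) (simp_all add: h, simp add: h_def)
    also have "\<dots> = ev h (Fract N 1 * Fract xvar N) (Fract N 1 * Fract yvar N) (Fract N 1 * Fract zvar N) G"
      by (simp only: cancel)
    also have "\<dots> = Fract N 1 ^ k * S G"
      unfolding S_def using h g(2) by (rule ev_homogeneous)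
    also have "Fract N 1 ^ k = Fract (N ^ k) 1"
      by (simp add: is_homD(7)[OF is_hom_fract])
    finally have "Fract 1 (N ^ k) * Fract G 1 = Fract 1 (N ^ k) * Fract (N ^ k) 1 * S G"
      by (simp only: mult.assoc)
    moreover have "Fract 1 (N ^ k) * Fract (N ^ k) 1 = (1 :: tripoly fract)"
      using N by (simp add: One_fract_def eq_fract)
    ultimately show ?thesis by simp
  qed
  ultimately have "Fract G (N ^ k) \<in> J"
    using cong[of G] by simp
  moreover have "Fract (N ^ k) H \<in> local_ring p"
    using g by (auto intro!: local_ringI power_N)
  moreover have "g = Fract G (N ^ k) * Fract (N ^ k) H"
    using g eval3_nz[OF power_N(2)] by (simp add: eq_fract)
  ultimately have "g \<in> J" by (simp only: J_mult)
  then show ?thesis by (auto simp: J_def)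
qed

lemma phi_tau_nz: "phi tau \<noteq> 0"
  using phi_tau by auto

lemma phi_tau_power_mult:
  assumes "s \<noteq> (0 :: complex fps)"
  shows "subdegree (phi tau ^ m * s) = m + subdegree s"
proof -
  obtain t where t: "phi tau = fps_X * t" "t $ 0 \<noteq> 0" using phi_tau by blast
  then have "t \<noteq> 0" by auto
  with t assms show ?thesis
    by (simp add: power_mult_distrib subdegree_mult subdegree_power subdegree_eq_0)
qed

text \<open>Modulo \<open>f\<close> the local ring behaves like a discrete valuation ring. As
  \<open>phi\<close> kills \<open>f\<close>, the order of \<open>g\<close> is \<open>m\<close> plus
  that of the cofactor \<open>u\<close>; if it exceeds \<open>m\<close>, then \<open>u\<close> lies
  in the maximal ideal and yields one more factor \<open>tau\<close>.\<close>

lemma divide_tau: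
  assumes "g \<in> local_ring p" "\<forall>i<m. phi g $ i = 0"
  shows "\<exists>u\<in>local_ring p. \<exists>v\<in>local_ring p. g = tau ^ m * u + f * v"
  using assms(2)
proof (induction m)
  case 0
  show ?case using assms(1) by (intro bexI[of _ g] bexI[of _ 0]) simp_all
next
  case (Suc m)
  then obtain u v where uv: "u \<in> local_ring p" "v \<in> local_ring p" "g = tau ^ m * u + f * v"
    by auto
  have "phi g = phi tau ^ m * phi u"
    using uv by (simp add: phi_add phi_mult phi_power phi_f)
  have "phi u $ 0 = 0"
  proof (rule ccontr)
    assume nz: "phi u $ 0 \<noteq> 0"
    then have u: "phi u \<noteq> 0" "subdegree (phi u) = 0" by auto
    have "subdegree (phi g) = m" "phi g \<noteq> 0"
      unfolding \<open>phi g = _\<close> phi_tau_power_mult[OF u(1)] using u phi_tau_nz by simp_all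
    then show False
      using Suc.prems by (metis lessI nth_subdegree_nonzero)
  qed
  then obtain u' v' where u': "u' \<in> local_ring p" "v' \<in> local_ring p" "u = tau * u' + f * v'"
    using maximal_ideal[OF uv(1)] by blast
  have "g = tau ^ Suc m * u' + f * (v + tau ^ m * v')"
    unfolding uv(3) u'(3) by (simp add: algebra_simps)
  moreover have "v + tau ^ m * v' \<in> local_ring p"
    using uv u' by simp
  ultimately show ?case using u' by blast
qed

section \<open>Intersection multiplicity as order along the arc\<close>

lemma phi_local_ideal:
  assumes C: "\<forall>i<m. E C $ i = 0" and g: "g \<in> local_ideal p C F" and i: "i < m"
  shows "phi g $ i = 0"
proof -
  have zero: "(s * E C * t) $ i = 0" for s t
  proof (cases "s * E C * t = 0")
    case False
    then have "m \<le> subdegree (E C)"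
      using C by (auto intro!: subdegree_geI)
    with False have "m \<le> subdegree (s * E C * t)"
      by (auto simp: subdegree_mult)
    with i show ?thesis by (intro nth_less_subdegree_zero) simp
  qed auto
  obtain u v H H' n n' where uv: "u \<in> local_ring p" "v \<in> local_ring p"
    "g = u * Fract C H + v * Fract F H'" "homogeneous n C" "homogeneous n H" "eval3 H p \<noteq> 0"
    "homogeneous n' F" "homogeneous n' H'" "eval3 H' p \<noteq> 0"
    using g by (auto simp: local_ideal_def local_equations_def)
  then have in': "Fract C H \<in> local_ring p" "Fract F H' \<in> local_ring p"
    by (auto intro: local_ringI)
  have "phi g = phi u * E C * inverse (E H)"
    using in' uv by (simp add: phi_add phi_mult phi_Fract EF mult.assoc)
  with zero show ?thesis by simp
qed

text \<open>The powers of \<open>tau\<close> below \<open>m\<close> have orders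
  \<open>0, ..., m - 1\<close>, whereas every element of the ideal has order at least
  \<open>m\<close>; hence they are independent modulo the ideal.\<close>

lemma intersection_mult_ge:
  assumes C: "\<forall>i<m. E C $ i = 0"
  shows "enat m \<le> intersection_mult p C F"
proof -
  have inj: "inj_on (\<lambda>i. tau ^ i) {..<m}"
  proof (rule inj_onI)
    fix i j assume "tau ^ i = tau ^ j"
    then have "phi tau ^ i = phi tau ^ j" by (simp flip: phi_power)
    then show "i = j" using phi_tau_power_mult[of 1 i] phi_tau_power_mult[of 1 j] by simp
  qed
  define B where "B = (\<lambda>i. tau ^ i) ` {..<m}"
  have "independent_mod (local_ideal p C F) B"
    unfolding independent_mod_def
  proof (intro allI impI)
    fix a
    define s where "s = (\<Sum>i<m. fps_const (a (tau ^ i)) * phi tau ^ i)"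
    assume "(\<Sum>b\<in>B. Fract (cst (a b)) 1 * b) \<in> local_ideal p C F"
    also have "(\<Sum>b\<in>B. Fract (cst (a b)) 1 * b) = (\<Sum>i<m. Fract (cst (a (tau ^ i))) 1 * tau ^ i)"
      unfolding B_def by (simp add: sum.reindex[OF inj])
    finally have "\<forall>i<m. phi (\<Sum>i<m. Fract (cst (a (tau ^ i))) 1 * tau ^ i) $ i = 0"
      using phi_local_ideal[OF C] by blast
    also have "phi (\<Sum>i<m. Fract (cst (a (tau ^ i))) 1 * tau ^ i) = s"
      unfolding s_def by (subst phi_sum) (simp_all add: phi_mult phi_const phi_power)
    finally have "\<forall>i<m. s $ i = 0" .
    moreover have "a (tau ^ k) = 0" if "k < m" "\<forall>i<m. s $ i = 0" for k
      using that(1)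
    proof (induction k rule: less_induct)
      case (less k)
      \<comment> \<open>Triangularity: smaller indices have coefficient 0 by induction, and larger
        powers of \<open>tau\<close> have order greater than \<open>k\<close>.\<close>
      have "s $ k = (\<Sum>i<m. if i = k then a (tau ^ k) * (phi tau ^ k) $ k else 0)"
        unfolding s_def fps_sum_nth
      proof (intro sum.cong refl)
        fix i assume "i \<in> {..<m}"
        consider "i < k" | "i = k" | "k < i" by linarith
        then show "(fps_const (a (tau ^ i)) * phi tau ^ i) $ k =
            (if i = k then a (tau ^ k) * (phi tau ^ k) $ k else 0)"
        proof cases
          case 3
          then have "(phi tau ^ i) $ k = 0"
            using phi_tau_power_mult[of 1 i] by (intro nth_less_subdegree_zero) simp
          with 3 show ?thesis by simp
        qed (use less in auto)
      qed
      moreover have "(phi tau ^ k) $ k \<noteq> 0"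
      proof -
        have "phi tau ^ k \<noteq> 0" using phi_tau by auto
        moreover have "subdegree (phi tau ^ k) = k" using phi_tau_power_mult[of 1 k] by simp
        ultimately show ?thesis by (metis nth_subdegree_nonzero)
      qed
      ultimately show ?case using that(2) less.prems by simp
    qed
    ultimately show "\<forall>b\<in>B. a b = 0" by (auto simp: B_def)
  qed
  moreover have "finite B" "card B = m" "B \<subseteq> local_ring p"
    by (auto simp: B_def card_image[OF inj])
  ultimately show ?thesis
    unfolding intersection_mult_def quotient_dim_def by (intro Sup_upper) auto
qed

text \<open>If the order is exactly \<open>m\<close>, then \<open>C\<close> is
  \<open>tau ^ m\<close> times a unit modulo \<open>f\<close>, so the ideal contains every element
  of order at least \<open>m\<close>. Among more than \<open>m\<close> elements some nontrivial
  combination has its first \<open>m\<close> coefficients zero and so lies in the ideal.\<close>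

lemma intersection_mult_le:
  assumes hom_C: "homogeneous k C" and C: "\<forall>i<m. E C $ i = 0" "E C $ m \<noteq> 0"
  shows "intersection_mult p C F \<le> enat m"
proof -
  define c where "c = Fract C (N ^ k)"
  have c_in: "c \<in> local_ring p" and phi_c: "phi c = E C * inverse (E (N ^ k))"
    using hom_C by (auto simp: c_def phi_Fract power_N intro!: local_ringI)
  have EC: "E C \<noteq> 0" using C by auto
  have sub: "subdegree (E C) = m" using C by (auto intro: subdegreeI)
  have inv: "inverse (E (N ^ k)) \<noteq> 0" "subdegree (inverse (E (N ^ k))) = 0"
    using power_N by (auto simp: E_nth_0 fps_inverse_eq_0_iff subdegree_eq_0)
  have "phi c \<noteq> 0" "subdegree (phi c) = m"
    using EC inv sub by (auto simp: phi_c)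
  then have "\<forall>i<m. phi c $ i = 0" by (auto intro: nth_less_subdegree_zero)
  then obtain u v where uv: "u \<in> local_ring p" "v \<in> local_ring p" "c = tau ^ m * u + f * v"
    using divide_tau[OF c_in] by blast
  then have "phi c = phi tau ^ m * phi u"
    by (simp add: phi_add phi_mult phi_power phi_f)
  with \<open>phi c \<noteq> 0\<close> \<open>subdegree (phi c) = m\<close> have "phi u $ 0 \<noteq> 0"
    using phi_tau_power_mult[of "phi u" m] by (metis add_cancel_right_right mult_zero_right subdegree_eq_0_iff)
  then obtain w where w: "w \<in> local_ring p" "u * w = 1"
    using local_ring_inverse uv by blast
  have ideal: "g \<in> local_ideal p C F" if g: "g \<in> local_ring p" "\<forall>i<m. phi g $ i = 0" for g
  proof -
    obtain u' v' where u': "u' \<in> local_ring p" "v' \<in> local_ring p" "g = tau ^ m * u' + f * v'"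
      using divide_tau[OF g] by blast
    have "g = tau ^ m * (u * w) * u' + f * v'"
      using u'(3) w(2) by simp
    \<comment> \<open>Here \<open>tau ^ m = w * (c - f * v)\<close> has been substituted.\<close>
    then have "g = (w * u') * c + (v' - v * w * u') * f"
      unfolding uv(3) by (simp add: algebra_simps)
    moreover have "w * u' \<in> local_ring p" "v' - v * w * u' \<in> local_ring p"
      using uv u' w by auto
    moreover have "c \<in> local_equations p C" "f \<in> local_equations p F"
      using hom_C hom_F power_N by (auto simp: local_equations_def c_def)
    ultimately show ?thesis unfolding local_ideal_def by blast
  qed
  have "card B \<le> m" if B: "finite B" "B \<subseteq> local_ring p" "independent_mod (local_ideal p C F) B" for B
  proof (rule ccontr)
    assume "\<not> card B \<le> m"
    then obtain a where a: "\<exists>b\<in>B. a b \<noteq> 0" "\<forall>i<m. (\<Sum>b\<in>B. a b * phi b $ i) = 0"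
      using nontrivial_solution[OF B(1), of m "\<lambda>b i. phi b $ i"] by auto
    let ?g = "\<Sum>b\<in>B. Fract (cst (a b)) 1 * b"
    have "phi ?g = (\<Sum>b\<in>B. fps_const (a b) * phi b)"
      using B(2) by (subst phi_sum) (auto simp: phi_mult phi_const subset_iff intro!: sum.cong)
    then have "\<forall>i<m. phi ?g $ i = 0"
      using a(2) by (simp add: fps_sum_nth)
    moreover have "?g \<in> local_ring p"
      using B(2) by (intro local_ring_sum) auto
    ultimately have "?g \<in> local_ideal p C F" by (rule ideal[rotated])
    with B(3) a(1) show False unfolding independent_mod_def by blast
  qed
  then show ?thesis
    unfolding intersection_mult_def quotient_dim_def by (intro Sup_least) auto
qed

text \<open>The upper bound read backwards, at the least index with a nonzero coefficient.\<close>

lemma E_nth_eq_0: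
  assumes "homogeneous k C" "enat m \<le> intersection_mult p C F" "i < m"
  shows "E C $ i = 0"
proof (rule ccontr)
  assume nz: "E C $ i \<noteq> 0"
  define j where "j = (LEAST i. E C $ i \<noteq> 0)"
  have "E C $ j \<noteq> 0" "\<forall>i<j. E C $ i = 0" "j \<le> i"
    using LeastI[of "\<lambda>i. E C $ i \<noteq> 0", OF nz] not_less_Least Least_le[of "\<lambda>i. E C $ i \<noteq> 0", OF nz]
    by (auto simp: j_def)
  then have "enat m \<le> enat j"
    using intersection_mult_le[OF assms(1)] assms(2) order_trans by blast
  with assms(3) \<open>j \<le> i\<close> show False by simp
qed

end

section \<open>Branches of the Fermat curve\<close>

text \<open>Since \<open>p2\<close> is nonzero, the curve is smooth with \<open>V3 / V1\<close> as
  local coordinate. In the affine coordinates \<open>q\<close> and \<open>r\<close> the equation is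
  \<open>(q - q(p)) * Sq + (r - r(p)) * Sr\<close>; dividing by the unit \<open>Sq\<close> expresses
  \<open>q - q(p)\<close> through the uniformizer and the equation. Points with
  \<open>p3 = 0\<close> are included, which covers the flexes.\<close>

lemma (in arc) fermat_branch:
  assumes d: "d > 0" and V: "{V1, V2, V3} = {xvar, yvar, zvar}"
    and F: "F = V1 ^ d + V2 ^ d + V3 ^ d" and EF: "E F = 0"
    and E1: "E V1 = fps_const p1" and E2: "E V2 $ 0 = p2" and E3: "E V3 = fps_const p3 + fps_X"
    and nz: "p1 \<noteq> 0" "p2 \<noteq> 0"
  shows "branch px py pz x y z F V1 (cst p1 * V3 - cst p3 * V1) d"
proof -
  have hom: "homogeneous 1 V1" "homogeneous 1 V2" "homogeneous 1 V3"
    using V by (metis One_nat_def homogeneous_vars insert_iff singletonD)+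
  have ev: "eval3 V1 p = p1" "eval3 V2 p = p2" "eval3 V3 p = p3"
    using E1 E2 E3 by (auto simp flip: E_nth_0)
  have F_hom: "homogeneous d F"
    using hom homogeneous_power[of 1 _ d] by (auto simp: F intro!: homogeneous_add)
  define T where "T = cst p1 * V3 - cst p3 * V1"
  have T_hom: "homogeneous 1 T"
    using hom by (auto simp: T_def intro!: homogeneous_diff homogeneous_cst_mult)
  have ET: "E T = fps_const p1 * fps_X"
    by (simp add: T_def E_hom E1 E3 algebra_simps)
  define h :: "complex \<Rightarrow> tripoly fract" where "h c = Fract (cst c) 1" for c
  have h: "is_hom h" unfolding h_def by (rule is_hom_fract_cst)
  have V1: "V1 \<noteq> 0" using ev nz eval3_nz by metis
  define q r where "q = Fract V2 V1" and "r = Fract V3 V1"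
  have in': "q \<in> local_ring p" "r \<in> local_ring p" "h c \<in> local_ring p" for c
    using hom ev nz by (auto simp: q_def r_def h_def intro!: local_ringI)
  define f0 t0 where "f0 = Fract F (V1 ^ d)" and "t0 = Fract T V1"
  have r: "r - h (p3 / p1) = t0 * h (1 / p1)"
  proof -
    have "cst p1 * cst (1 / p1) = 1" "cst p3 * cst (1 / p1) = cst (p3 / p1)"
      using nz by (simp_all flip: cst_hom)
    then have "V3 - cst (p3 / p1) * V1 = T * cst (1 / p1)"
      unfolding T_def by algebra
    then show ?thesis
      using V1 by (simp add: r_def h_def t0_def eq_fract)
  qed
  define Sq where "Sq = (\<Sum>i<d. h (p2 / p1) ^ (d - Suc i) * q ^ i)"
  define Sr where "Sr = (\<Sum>i<d. h (p3 / p1) ^ (d - Suc i) * r ^ i)"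
  have S_in: "Sq \<in> local_ring p" "Sr \<in> local_ring p"
    using in' by (auto simp: Sq_def Sr_def intro!: local_ring_sum)
  \<comment> \<open>The value of \<open>Sq\<close> at \<open>p\<close> is
    \<open>d * (p2 / p1) ^ (d - 1)\<close>, a derivative of the affine equation.\<close>
  have "phi Sq $ 0 = (\<Sum>i<d. (p2 / p1) ^ (d - Suc i) * (p2 / p1) ^ i)"
  proof -
    have "phi q $ 0 = p2 / p1"
      using nz by (simp add: q_def phi_Fract E_nth_0 ev divide_inverse)
    then show ?thesis
      using in' by (simp add: Sq_def phi_sum phi_mult phi_power h_def phi_const fps_sum_nth
          fps_power_zeroth fps_const_power)
  qed
  also have "\<dots> = (\<Sum>i<d. (p2 / p1) ^ (d - 1))"
    by (intro sum.cong) (auto simp flip: power_add)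
  also have "\<dots> \<noteq> 0" using d nz by simp
  finally obtain w where w: "w \<in> local_ring p" "Sq * w = 1"
    using local_ring_inverse S_in by blast
  have "p1 ^ d + p2 ^ d + p3 ^ d = eval3 F p"
    by (simp add: F eval3_hom ev)
  also have "\<dots> = 0" using EF E_nth_0[of F] by simp
  finally have "1 + (p2 / p1) ^ d + (p3 / p1) ^ d = 0"
    using nz by (simp add: power_divide field_simps)
  then have "h (1 + (p2 / p1) ^ d + (p3 / p1) ^ d) = h 0"
    by simp
  then have 0: "1 + h (p2 / p1) ^ d + h (p3 / p1) ^ d = 0"
    by (simp only: is_homD[OF h])
  have "f0 = 1 + q ^ d + r ^ d"
  proof -
    have fr: "Fract a b = Fract a 1 / Fract b 1" for a b :: tripoly
      by simp
    have "Fract V1 1 \<noteq> (0 :: tripoly fract)"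
      using V1 by (simp add: Zero_fract_def eq_fract)
    then show ?thesis
      unfolding q_def r_def f0_def F fr[of _ "V1 ^ d"] fr[of _ V1] is_homD[OF is_hom_fract]
      by (simp add: power_divide add_divide_distrib del: divide_fract)
  qed
  \<comment> \<open>The affine equation at \<open>p\<close> is split off, which leaves two
    differences of \<open>d\<close>-th powers.\<close>
  also have "\<dots> = (q ^ d - h (p2 / p1) ^ d) + (r ^ d - h (p3 / p1) ^ d)
      + (1 + h (p2 / p1) ^ d + h (p3 / p1) ^ d)"
    by simp
  also have "\<dots> = (q - h (p2 / p1)) * Sq + (r - h (p3 / p1)) * Sr"
    unfolding 0 by (simp add: power_diff_sumr2 Sq_def Sr_def)
  finally have "f0 = (q - h (p2 / p1)) * Sq + (r - h (p3 / p1)) * Sr" .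
  then have "q - h (p2 / p1) = f0 * w - (r - h (p3 / p1)) * Sr * w"
    using w(2) by algebra
  also have "\<dots> = t0 * (- (h (1 / p1) * Sr * w)) + f0 * w"
    unfolding r by (simp add: algebra_simps)
  finally have q: "q - h (p2 / p1) = t0 * (- (h (1 / p1) * Sr * w)) + f0 * w" .
  have "\<exists>u\<in>local_ring p. \<exists>v\<in>local_ring p.
      Fract W V1 - h (eval3 W p / eval3 V1 p) = t0 * u + f0 * v"
    if "W \<in> {xvar, yvar, zvar}" for W
  proof -
    have "W \<in> {V1, V2, V3}" using that unfolding V .
    then consider "W = V1" | "W = V2" | "W = V3" by auto
    then show ?thesis
    proof cases
      case 1
      have "Fract V1 V1 = 1"
        using V1 by (simp add: One_fract_def eq_fract)
      then have "Fract V1 V1 - h (p1 / p1) = t0 * 0 + f0 * 0"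
        using nz by (simp add: is_homD[OF h])
      then show ?thesis unfolding 1 ev by (intro bexI[of _ 0]) auto
    next
      case 2
      from q show ?thesis
        unfolding 2 ev q_def using in' S_in w
        by (intro bexI[of _ "- (h (1 / p1) * Sr * w)"] bexI[of _ w]) auto
    next
      case 3
      from r show ?thesis
        unfolding 3 ev r_def using in'
        by (intro bexI[of _ "h (1 / p1)"] bexI[of _ 0]) auto
    qed
  qed
  then show ?thesis
    unfolding T_def[symmetric]
    using F_hom T_hom hom EF ET nz
    by unfold_locales (auto simp: ev h_def f0_def t0_def p_def[symmetric] E_def[symmetric])
qed

lemma fermat_root:
  fixes p1 p2 p3 :: complex
  assumes "d > 0" "p2 \<noteq> 0" "p1 ^ d + p2 ^ d + p3 ^ d = 0"
  shows "\<exists>q. q $ 0 = p2 \<and> fps_const p1 ^ d + q ^ d + (fps_const p3 + fps_X) ^ d = 0"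
proof -
  define G where "G = - (fps_const p1 ^ d) - (fps_const p3 + fps_X) ^ d"
  have G0: "G $ 0 = p2 ^ d"
    using assms(3) by (simp add: G_def fps_power_zeroth) (simp add: add_eq_0_iff algebra_simps)
  obtain k where d: "d = Suc k" using assms(1) gr0_implies_Suc by blast
  \<comment> \<open>The first argument of \<open>fps_radical\<close> chooses the root of the
    constant term. Choosing \<open>p2\<close> fixes the branch through \<open>p\<close>.\<close>
  let ?q = "fps_radical (\<lambda>_ _. p2) (Suc k) G"
  have "?q ^ Suc k = G"
    using power_radical[of G "\<lambda>_ _. p2" k] G0 assms(2) d by (auto simp del: power_Suc)
  then show ?thesis
    by (intro exI[of _ ?q]) (simp add: d G_def del: power_Suc)
qed

section \<open>Conics\<close>

definition quad :: "tripoly \<Rightarrow> tripoly \<Rightarrow> tripoly \<Rightarrow> complex \<Rightarrow> complex \<Rightarrow> complex \<Rightarrow> complex \<Rightarrow>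
    complex \<Rightarrow> complex \<Rightarrow> tripoly" where
  "quad X Y Z a b c e f g = cst a * X ^ 2 + cst b * Y ^ 2 + cst c * Z ^ 2
     + cst e * X * Y + cst f * X * Z + cst g * Y * Z"

definition fquad :: "complex fps \<Rightarrow> complex fps \<Rightarrow> complex fps \<Rightarrow> complex \<Rightarrow> complex \<Rightarrow> complex \<Rightarrow>
    complex \<Rightarrow> complex \<Rightarrow> complex \<Rightarrow> complex fps" where
  "fquad X Y Z a b c e f g = fps_const a * X ^ 2 + fps_const b * Y ^ 2 + fps_const c * Z ^ 2
     + fps_const e * X * Y + fps_const f * X * Z + fps_const g * Y * Z"

lemma (in arc) E_quad: "E (quad X Y Z a b c e f g) = fquad (E X) (E Y) (E Z) a b c e f g"
  by (simp add: quad_def fquad_def E_hom)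

lemma quad_cyclic: "quad X Y Z a b c e f g = quad Y Z X b c a g e f"
  by (simp add: quad_def algebra_simps)

lemma quad_xyz: "quad xvar yvar zvar a b c e f g =
    [:[:[:0, 0, a:], [:0, e:], [:b:]:], [:[:0, f:], [:g:]:], [:[:c:]:]:]"
  by (simp add: quad_def cst_def xvar_def yvar_def zvar_def power2_eq_square)

text \<open>Rotations suffice to bring a vanishing coordinate to the last place, so that only one
  kind of flex has to be treated.\<close>

definition cyclic_vars :: "tripoly \<Rightarrow> tripoly \<Rightarrow> tripoly \<Rightarrow> bool" where
  "cyclic_vars X Y Z \<longleftrightarrow>
     (X, Y, Z) \<in> {(xvar, yvar, zvar), (yvar, zvar, xvar), (zvar, xvar, yvar)}"

lemma quad_eq_0:
  assumes "cyclic_vars X Y Z"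
  shows "quad X Y Z a b c e f g = 0 \<longleftrightarrow> a = 0 \<and> b = 0 \<and> c = 0 \<and> e = 0 \<and> f = 0 \<and> g = 0"
proof -
  have *: "quad xvar yvar zvar a b c e f g = 0 \<longleftrightarrow> a = 0 \<and> b = 0 \<and> c = 0 \<and> e = 0 \<and> f = 0 \<and> g = 0"
    for a b c e f g by (auto simp: quad_xyz)
  show ?thesis
    using assms unfolding cyclic_vars_def
    by (auto simp: * quad_cyclic[of yvar zvar xvar] quad_cyclic[of zvar xvar yvar])
qed

lemma homogeneous_quad:
  assumes "cyclic_vars X Y Z"
  shows "homogeneous 2 (quad X Y Z a b c e f g)"
proof -
  have hom: "homogeneous 1 X" "homogeneous 1 Y" "homogeneous 1 Z"
    using assms by (auto simp: cyclic_vars_def)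
  show ?thesis
    using hom homogeneous_mult[of 1 _ 1]
    by (auto simp: quad_def power2_eq_square mult.assoc numeral_2_eq_2
        intro!: homogeneous_add homogeneous_cst_mult)
qed

lemma homogeneous_2_quad:
  assumes D: "homogeneous 2 D" and cyc: "cyclic_vars X Y Z"
  shows "\<exists>a b c e f g. D = quad X Y Z a b c e f g"
proof -
  define k where "k i j l = coeff (coeff (coeff D l) j) i" for i j l
  have k: "k i j l = 0" if "i + j + l \<noteq> 2" for i j l
    using D that by (auto simp: homogeneous_def k_def)
  have "D = quad xvar yvar zvar (k 2 0 0) (k 0 2 0) (k 0 0 2) (k 1 1 0) (k 1 0 1) (k 0 1 1)"
    unfolding quad_xyz
  proof (intro poly_eqI, unfold k_def[symmetric])
    fix i j l
    show "k i j l = coeff (coeff (coeff [:[:[:0, 0, k 2 0 0:], [:0, k 1 1 0:], [:k 0 2 0:]:],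
       [:[:0, k 1 0 1:], [:k 0 1 1:]:], [:[:k 0 0 2:]:]:] l) j) i"
      by (cases "i + j + l = 2") (auto simp: coeff_pCons k numeral_2_eq_2 split: nat.splits)
  qed
  then obtain a b c e f g where "D = quad xvar yvar zvar a b c e f g" by blast
  then have "D = quad xvar yvar zvar a b c e f g" "D = quad yvar zvar xvar b c a g e f"
    "D = quad zvar xvar yvar c a b f g e"
    using quad_cyclic by simp_all
  with cyc show ?thesis
    unfolding cyclic_vars_def by blast
qed

lemma cst_mult_quad: "cst k * quad X Y Z a b c e f g =
    quad X Y Z (k * a) (k * b) (k * c) (k * e) (k * f) (k * g)"
  by (simp add: quad_def cst_hom algebra_simps)

section \<open>Coefficients of the stated conic in rotated coordinates\<close>

definition osc_square :: "nat \<Rightarrow> complex \<Rightarrow> complex \<Rightarrow> complex \<Rightarrow> complex" where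
  "osc_square d p q r = p ^ (2 * d - 2) * (of_nat d + 1) *
     ((2 * of_nat d - 1) * q ^ d * r ^ d + (2 - of_nat d) * (q ^ d + r ^ d) * p ^ d)"

text \<open>The minus sign of the stated polynomial is included; \<open>r\<close> is the coordinate
  absent from the monomial.\<close>

definition osc_mixed :: "nat \<Rightarrow> complex \<Rightarrow> complex \<Rightarrow> complex \<Rightarrow> complex" where
  "osc_mixed d p q r = - (2 * (of_nat d + 1) * (of_nat d - 2) * p ^ (2 * d - 1) * q ^ (2 * d - 1)
     + 4 * (2 * of_nat d - 1) * (of_nat d - 2)
       * (p ^ (d - 1) * q ^ (2 * d - 1) + p ^ (2 * d - 1) * q ^ (d - 1)) * r ^ d)"

lemma osc_sym: "osc_square d p q r = osc_square d p r q" "osc_mixed d p q r = osc_mixed d q p r"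
  by (simp_all add: osc_square_def osc_mixed_def algebra_simps)

text \<open>Rotating the variables and the coordinates of the point together preserves the stated
  polynomial, by the symmetries of its coefficients.\<close>

lemma osculating_poly_quad:
  assumes "cyclic_vars X Y Z"
  shows "osculating_poly d p = (let p1 = eval3 X p; p2 = eval3 Y p; p3 = eval3 Z p in
     quad X Y Z (osc_square d p1 p2 p3) (osc_square d p2 p3 p1) (osc_square d p3 p1 p2)
       (osc_mixed d p1 p2 p3) (osc_mixed d p1 p3 p2) (osc_mixed d p2 p3 p1))"
proof -
  obtain px py pz where p: "p = (px, py, pz)" by (cases p)
  have *: "osculating_poly d p =
     quad xvar yvar zvar (osc_square d px py pz) (osc_square d py pz px) (osc_square d pz px py)
       (osc_mixed d px py pz) (osc_mixed d px pz py) (osc_mixed d py pz px)"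
    unfolding osculating_poly_def p prod.case quad_def osc_mixed_def osc_sym(1)[of d py pz px]
    by (simp only: osc_square_def cst_hom(5) minus_mult_left[symmetric] diff_conv_add_uminus)
  show ?thesis
    using assms unfolding cyclic_vars_def
  proof (elim insertE emptyE)
    assume "(X, Y, Z) = (xvar, yvar, zvar)"
    then show ?thesis by (simp add: *[unfolded p] p)
  next
    assume "(X, Y, Z) = (yvar, zvar, xvar)"
    then show ?thesis
      by (simp add: *[unfolded p] p quad_cyclic[of xvar yvar zvar] osc_sym(2))
  next
    assume "(X, Y, Z) = (zvar, xvar, yvar)"
    then show ?thesis
      by (simp add: *[unfolded p] p quad_cyclic[of zvar xvar yvar] osc_sym(2))
  qed
qed

lemma fermat_arc:
  assumes d: "d > 0" and cyc: "cyclic_vars X Y Z" and p: "eval3 (fermat_curve d) (px, py, pz) = 0"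
    and nz: "eval3 X (px, py, pz) \<noteq> 0" "eval3 Y (px, py, pz) \<noteq> 0"
  defines "p1 \<equiv> eval3 X (px, py, pz)" and "p2 \<equiv> eval3 Y (px, py, pz)" and "p3 \<equiv> eval3 Z (px, py, pz)"
  obtains x y z q where
    "branch px py pz x y z (fermat_curve d) X (cst p1 * Z - cst p3 * X) d"
    "ev fps_const x y z X = fps_const p1" "ev fps_const x y z Y = q"
    "ev fps_const x y z Z = fps_const p3 + fps_X"
    "q $ 0 = p2" "fps_const p1 ^ d + q ^ d + (fps_const p3 + fps_X) ^ d = 0"
proof -
  have F: "fermat_curve d = X ^ d + Y ^ d + Z ^ d"
    using cyc by (auto simp: cyclic_vars_def fermat_curve_def)
  have V: "{X, Y, Z} = {xvar, yvar, zvar}"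
    using cyc by (auto simp: cyclic_vars_def)
  have "p1 ^ d + p2 ^ d + p3 ^ d = 0"
    using p by (simp add: F p1_def p2_def p3_def eval3_hom)
  then obtain q where q: "q $ 0 = p2" "fps_const p1 ^ d + q ^ d + (fps_const p3 + fps_X) ^ d = 0"
    using fermat_root[of d p2 p1 p3] nz d by (auto simp: p2_def)
  \<comment> \<open>The three series are put back at the places of the original coordinates, undoing
    the rotation.\<close>
  have "\<exists>x y z. ev fps_const x y z X = fps_const p1 \<and> ev fps_const x y z Y = q \<and>
      ev fps_const x y z Z = fps_const p3 + fps_X \<and> x $ 0 = px \<and> y $ 0 = py \<and> z $ 0 = pz"
    using cyc unfolding cyclic_vars_def
  proof (elim insertE emptyE)
    assume "(X, Y, Z) = (xvar, yvar, zvar)"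
    then show ?thesis
      using q(1) by (intro exI[of _ "fps_const p1"] exI[of _ q] exI[of _ "fps_const p3 + fps_X"])
        (auto simp: is_hom_fps_const p1_def p2_def p3_def)
  next
    assume "(X, Y, Z) = (yvar, zvar, xvar)"
    then show ?thesis
      using q(1) by (intro exI[of _ "fps_const p3 + fps_X"] exI[of _ "fps_const p1"] exI[of _ q])
        (auto simp: is_hom_fps_const p1_def p2_def p3_def)
  next
    assume "(X, Y, Z) = (zvar, xvar, yvar)"
    then show ?thesis
      using q(1) by (intro exI[of _ q] exI[of _ "fps_const p3 + fps_X"] exI[of _ "fps_const p1"])
        (auto simp: is_hom_fps_const p1_def p2_def p3_def)
  qed
  then obtain x y z where vals: "ev fps_const x y z X = fps_const p1" "ev fps_const x y z Y = q"
      "ev fps_const x y z Z = fps_const p3 + fps_X" "x $ 0 = px" "y $ 0 = py" "z $ 0 = pz"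
    by blast
  interpret arc px py pz x y z "(px, py, pz)" "ev fps_const x y z"
    using vals by unfold_locales auto
  have "branch px py pz x y z (fermat_curve d) X (cst p1 * Z - cst p3 * X) d"
  proof (rule fermat_branch[OF d V F, where ?p2.0 = p2])
    show "ev fps_const x y z (fermat_curve d) = 0"
      by (simp only: F E_hom vals q(2))
  qed (use vals q nz in \<open>simp_all add: p1_def p2_def\<close>)
  with vals(1-3) q that show thesis by blast
qed

text \<open>Every conic other than \<open>K\<close> has multiplicity at most \<open>d + 1\<close>.
  This is less than \<open>2 * d\<close>, and for \<open>d = 3\<close> it is 4, so that the bound 5
  already singles out \<open>K\<close>.\<close>

lemma (in branch) hyperosculating_cases:
  assumes d: "d \<ge> 3" and F: "F = fermat_curve d"
    and K: "is_conic K" "\<forall>i<2 * d. E K $ i = 0"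
    and unique: "\<And>D. is_conic D \<Longrightarrow> \<forall>i<d + 2. E D $ i = 0 \<Longrightarrow> same_curve K D"
  shows "(d = 3 \<longrightarrow> is_osculating_conic d p K) \<and> is_hyperosculating_conic d p K"
proof -
  have K_ge: "enat (2 * d) \<le> intersection_mult p K F"
    using K(2) by (rule intersection_mult_ge)
  have "5 \<le> enat (2 * d)" using d by (simp add: numeral_eq_enat)
  with K_ge have K5: "5 \<le> intersection_mult p K F" by (rule order_trans[rotated])
  have lt: "intersection_mult p D F \<le> enat (d + 1)" if D: "is_conic D" "\<not> same_curve K D" for D
  proof (rule ccontr)
    assume "\<not> intersection_mult p D F \<le> enat (d + 1)"
    then have "enat (d + 2) \<le> intersection_mult p D F"
      by (cases "intersection_mult p D F") auto
    then have "\<forall>i<d + 2. E D $ i = 0"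
      using E_nth_eq_0[of 2 D] D(1) by (auto simp: is_conic_def)
    with unique D show False by blast
  qed
  show ?thesis
    unfolding is_osculating_conic_def is_hyperosculating_conic_def F[symmetric]
  proof (intro conjI impI allI K(1) K5)
    fix D assume "d = 3" "is_conic D \<and> 5 \<le> intersection_mult p D F"
    show "same_curve K D"
    proof (rule ccontr)
      assume "\<not> same_curve K D"
      then have "intersection_mult p D F \<le> enat 4"
        using lt[of D] \<open>d = 3\<close> \<open>is_conic D \<and> _\<close> by simp
      then have "(5 :: enat) \<le> enat 4"
        using \<open>is_conic D \<and> _\<close> order_trans by blast
      then show False by (simp add: numeral_eq_enat)
    qed
  next
    fix D assume D: "is_conic D \<and> 5 \<le> intersection_mult p D F \<and> \<not> same_curve K D"
    have "intersection_mult p D F \<le> enat (d + 1)" using lt D by blast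
    also have "enat (d + 1) < enat (2 * d)" using d by simp
    also note K_ge
    finally show "intersection_mult p D F < intersection_mult p K F" .
  qed
qed

section \<open>The branch at a flex\<close>

text \<open>Here \<open>q ^ d - p2 ^ d = - (X ^ d)\<close>, and the left side is
  \<open>q - p2\<close> times a series with constant term \<open>d * p2 ^ (d - 1)\<close>, hence
  times a unit.\<close>

lemma flex_root:
  fixes q :: "complex fps"
  assumes d: "d > 0" and p2: "p2 \<noteq> 0" and q0: "q $ 0 = p2"
    and q: "fps_const p1 ^ d + q ^ d + fps_X ^ d = 0"
  shows "\<exists>s. q = fps_const p2 + fps_X ^ d * s \<and> s $ 0 \<noteq> 0"
proof -
  define S where "S = (\<Sum>i<d. fps_const p2 ^ (d - Suc i) * q ^ i)"
  have "S $ 0 = (\<Sum>i<d. p2 ^ (d - 1))"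
    unfolding S_def fps_sum_nth
    by (intro sum.cong) (auto simp: fps_power_zeroth q0 simp flip: power_add)
  then have S0: "S $ 0 \<noteq> 0" using d p2 by simp
  have "(fps_const p1 ^ d + q ^ d + fps_X ^ d) $ 0 = 0" unfolding q by simp
  then have "p1 ^ d + p2 ^ d = 0"
    using d by (simp add: fps_power_zeroth q0 zero_power)
  then have "p1 ^ d = - (p2 ^ d)" by (simp add: add_eq_0_iff2)
  then have "fps_const p1 ^ d = - (fps_const p2 ^ d)" by simp
  moreover have "w - v = - u" if "- v + w + u = 0" for u v w :: "complex fps"
    using that by algebra
  ultimately have "q ^ d - fps_const p2 ^ d = - (fps_X ^ d)"
    using q by metis
  then have "(q - fps_const p2) * S = - (fps_X ^ d)"
    by (simp only: power_diff_sumr2 S_def)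
  moreover have "S * inverse S = 1"
    using S0 by (rule inverse_mult_eq_1')
  ultimately have "q - fps_const p2 = - (fps_X ^ d) * inverse S"
    by (metis mult.assoc mult.right_neutral)
  then have "q = fps_const p2 + fps_X ^ d * (- inverse S)"
    by (simp add: algebra_simps)
  moreover have "(- inverse S) $ 0 \<noteq> 0" using S0 by simp
  ultimately show ?thesis by blast
qed

text \<open>Sorted by powers of the parameter: for \<open>d \<ge> 3\<close> the exponents 0, 1, 2,
  \<open>d\<close>, \<open>d + 1\<close>, \<open>2 * d\<close> increase strictly, so the brackets
  can be read off one after another although \<open>s\<close> is not constant.\<close>

lemma flex_fquad_expand:
  fixes s :: "complex fps" and p2 :: complex and d :: nat
  defines "q \<equiv> fps_const p2 + fps_X ^ d * s"
  shows "fquad (fps_const p1) q fps_X a b c e f g =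
    fps_const (a * p1 ^ 2 + b * p2 ^ 2 + e * p1 * p2) + fps_X * fps_const (f * p1 + g * p2)
    + fps_X ^ 2 * fps_const c + fps_X ^ d * (fps_const (2 * b * p2 + e * p1) * s)
    + fps_X ^ (d + 1) * (fps_const g * s) + fps_X ^ (2 * d) * (fps_const b * s ^ 2)"
proof -
  have X: "fps_X ^ (d + 1) = fps_X * (fps_X :: complex fps) ^ d"
    "fps_X ^ (2 * d) = ((fps_X :: complex fps) ^ d) ^ 2"
    by (simp_all add: power_mult mult.commute)
  have const: "fps_const 2 = (2 :: complex fps)" 
    by (simp add: numeral_fps_const)
  show ?thesis
    unfolding X q_def fquad_def power2_eq_square
    by (simp only: fps_const_add[symmetric] fps_const_mult[symmetric] const) algebra
qed

text \<open>The conditions at the indices 0, 1, 2, \<open>d\<close> and \<open>d + 1\<close> leave a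
  line of solutions, spanned by the square of the tangent \<open>p2 * X - p1 * Y\<close>.\<close>

lemma flex_fquad_zero:
  fixes q :: "complex fps"
  assumes d: "d \<ge> 3" and nz: "p1 \<noteq> 0" "p2 \<noteq> 0" and q0: "q $ 0 = p2"
    and q: "fps_const p1 ^ d + q ^ d + fps_X ^ d = 0"
    and zero: "\<forall>i<d + 2. fquad (fps_const p1) q fps_X a b c e f g $ i = 0"
  shows "c = 0 \<and> f = 0 \<and> g = 0 \<and> e * p1 = - 2 * b * p2 \<and> a * p1 ^ 2 = b * p2 ^ 2"
proof -
  obtain s where s: "q = fps_const p2 + fps_X ^ d * s" "s $ 0 \<noteq> 0"
    using flex_root[OF _ nz(2) q0 q] d by auto
  note * = zero[unfolded s(1) flex_fquad_expand, rule_format]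
  have 0: "a * p1 ^ 2 + b * p2 ^ 2 + e * p1 * p2 = 0"
    using *[of 0] d by simp
  have 1: "f * p1 + g * p2 = 0"
    using *[of 1] d by (simp add: fps_X_power_mult_nth del: power_Suc)
  have 2: "c = 0"
    using *[of 2] d by (simp add: fps_X_power_mult_nth del: power_Suc)
  have 3: "2 * b * p2 + e * p1 = 0"
    using *[of d] d s(2) by (simp add: fps_X_power_mult_nth del: power_Suc)
  \<comment> \<open>The bracket at exponent \<open>d\<close> would contribute the next coefficient
    of \<open>s\<close>, but it vanishes by fact 3.\<close>
  have 4: "g = 0"
    using *[of "d + 1"] d s(2) by (simp add: fps_X_power_mult_nth 3 del: power_Suc)
  show ?thesis
    using 0 1 2 3 4 nz by (auto simp: add_eq_0_iff power2_eq_square)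
qed

text \<open>All brackets vanish except the one at exponent \<open>2 * d\<close>: the tangent has
  order \<open>d\<close>, its square twice that.\<close>

lemma flex_fquad_order:
  fixes q :: "complex fps"
  assumes d: "d \<ge> 3" and nz: "p1 \<noteq> 0" "p2 \<noteq> 0" and q0: "q $ 0 = p2"
    and q: "fps_const p1 ^ d + q ^ d + fps_X ^ d = 0"
    and coeffs: "e * p1 = - 2 * b * p2" "a * p1 ^ 2 = b * p2 ^ 2"
    and i: "i < 2 * d"
  shows "fquad (fps_const p1) q fps_X a b 0 e 0 0 $ i = 0"
proof -
  obtain s where s: "q = fps_const p2 + fps_X ^ d * s" "s $ 0 \<noteq> 0"
    using flex_root[OF _ nz(2) q0 q] d by auto
  have "a * p1 ^ 2 + b * p2 ^ 2 + e * p1 * p2 = 0" "2 * b * p2 + e * p1 = 0"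
    using coeffs by algebra+
  then show ?thesis
    unfolding s(1) flex_fquad_expand using i by (simp add: fps_X_power_mult_nth del: power_Suc)
qed

section \<open>The branch at a point that is not a flex\<close>

lemma fps_mult_nth_upto_4:
  fixes a b :: "'a::comm_ring_1 fps"
  shows "(a * b) $ 0 = a $ 0 * b $ 0"
    "(a * b) $ 1 = a $ 0 * b $ 1 + a $ 1 * b $ 0"
    "(a * b) $ 2 = a $ 0 * b $ 2 + a $ 1 * b $ 1 + a $ 2 * b $ 0"
    "(a * b) $ 3 = a $ 0 * b $ 3 + a $ 1 * b $ 2 + a $ 2 * b $ 1 + a $ 3 * b $ 0"
    "(a * b) $ 4 = a $ 0 * b $ 4 + a $ 1 * b $ 3 + a $ 2 * b $ 2 + a $ 3 * b $ 1 + a $ 4 * b $ 0"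
  by (simp_all add: fps_mult_nth eval_nat_numeral add_ac)

text \<open>A second differentiation, with the first identity used to eliminate the powers, gives an
  equation in which \<open>d\<close> is only a coefficient. It can be compared termwise for
  unspecified \<open>d\<close>.\<close>

lemma fermat_ode:
  fixes q r :: "complex fps"
  assumes d: "d \<ge> 2" and q0: "q \<noteq> 0" and r: "fps_deriv r = 1"
    and eq: "fps_const c + q ^ d + r ^ d = 0"
  shows "fps_deriv q * q ^ (d - 1) = - (r ^ (d - 1))"
    "r * q * fps_deriv (fps_deriv q)
       = fps_const (of_nat d - 1) * fps_deriv q * (q - r * fps_deriv q)"
proof -
  obtain n where n: "d = Suc (Suc n)"
    using d by (metis Suc_le_D numeral_2_eq_2 Suc_le_mono)
  let ?q' = "fps_deriv q" and ?q'' = "fps_deriv (fps_deriv q)"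
  have "fps_deriv (fps_const c + q ^ d + r ^ d) = 0" unfolding eq by simp
  then have "of_nat d * (?q' * q ^ (d - 1) + r ^ (d - 1)) = 0"
    by (simp add: fps_deriv_power' r algebra_simps)
  moreover have "(of_nat d :: complex fps) \<noteq> 0"
    using d by (metis fps_of_nat fps_const_eq_0_iff of_nat_eq_0_iff not_numeral_le_zero)
  ultimately show 1: "?q' * q ^ (d - 1) = - (r ^ (d - 1))"
    by (simp add: add_eq_0_iff2)
  then have "fps_deriv (?q' * q ^ Suc n) = fps_deriv (- (r ^ Suc n))"
    by (simp add: n)
  then have 2: "?q'' * q ^ Suc n + of_nat (Suc n) * ?q' * ?q' * q ^ n = - of_nat (Suc n) * r ^ n"
    by (simp only: fps_deriv_mult fps_deriv_power' fps_deriv_neg r diff_Suc_1) (simp add: algebra_simps)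
  \<comment> \<open>The extra power of \<open>q\<close> makes both derivative identities applicable;
    it is cancelled at the end.\<close>
  have "(r * q * ?q'') * q ^ Suc n
      = r * q * (?q'' * q ^ Suc n + of_nat (Suc n) * ?q' * ?q' * q ^ n)
        - of_nat (Suc n) * r * ?q' * ?q' * q ^ Suc n"
    by (simp add: algebra_simps)
  also have "\<dots> = q * of_nat (Suc n) * (- (r ^ Suc n)) - of_nat (Suc n) * r * ?q' * ?q' * q ^ Suc n"
    unfolding 2 by (simp add: algebra_simps)
  also have "- (r ^ Suc n) = ?q' * q ^ Suc n" using 1 n by simp
  finally have "(r * q * ?q'') * q ^ Suc n = (of_nat (Suc n) * ?q' * (q - r * ?q')) * q ^ Suc n"
    by (simp add: algebra_simps)
  moreover have "of_nat (Suc n) = fps_const (of_nat d - 1 :: complex)"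
    by (simp add: n fps_of_nat[symmetric] del: of_nat_Suc) simp
  ultimately show "r * q * ?q'' = fps_const (of_nat d - 1) * ?q' * (q - r * ?q')"
    using q0 by simp
qed

text \<open>
  \<open>t\<close> is the logarithmic slope of the branch at \<open>p\<close>; in the coordinates scaled by \<open>p\<^sub>y\<close> and \<open>p\<^sub>z\<close>
  the Taylor coefficients of the branch are polynomials in \<open>t\<close> and \<open>d\<close>.
\<close>

definition taylor2 :: "complex \<Rightarrow> complex \<Rightarrow> complex" where
  "taylor2 m t = (m - 1) * t * (1 - t) / 2"

definition taylor3 :: "complex \<Rightarrow> complex \<Rightarrow> complex" where
  "taylor3 m t = taylor2 m t * ((m - 1) * (1 - 2 * t) - t - 1) / 3"

definition taylor4 :: "complex \<Rightarrow> complex \<Rightarrow> complex" where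
  "taylor4 m t = ((m - 1) * (3 * taylor3 m t * (1 - 2 * t) - t * taylor2 m t - 4 * taylor2 m t ^ 2)
     - 6 * t * taylor3 m t - 2 * taylor2 m t ^ 2 - 6 * taylor3 m t - 2 * t * taylor2 m t) / 12"

text \<open>Coefficient \<open>i\<close> of the differential equation determines coefficient
  \<open>i + 2\<close> of \<open>q\<close>, its factor being
  \<open>(i + 1) * (i + 2) * p2 * p3\<close>. The slope comes from the first-order identity at
  0.\<close>

lemma fermat_taylor:
  fixes q :: "complex fps"
  assumes d: "d \<ge> 2" and p2: "q $ 0 = p2" "p2 \<noteq> 0" and p3: "p3 \<noteq> 0"
    and eq: "fps_const p1 ^ d + q ^ d + (fps_const p3 + fps_X) ^ d = 0"
  defines "t \<equiv> - (p3 ^ d / p2 ^ d)" and "m \<equiv> of_nat d"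
  shows "q $ 1 * p3 = p2 * t" "q $ 2 * p3 ^ 2 = p2 * taylor2 m t"
    "q $ 3 * p3 ^ 3 = p2 * taylor3 m t" "q $ 4 * p3 ^ 4 = p2 * taylor4 m t"
proof -
  let ?r = "fps_const p3 + fps_X"
  have "q \<noteq> 0" using p2 by auto
  have eq': "fps_const (p1 ^ d) + q ^ d + ?r ^ d = 0" using eq by simp
  note ode = fermat_ode[OF d \<open>q \<noteq> 0\<close> _ eq', simplified]
  have "(fps_deriv q * q ^ (d - 1)) $ 0 = - (?r ^ (d - 1)) $ 0"
    using ode(1) by simp
  then have "q $ 1 * p2 ^ (d - 1) = - (p3 ^ (d - 1))"
    by (simp add: fps_power_zeroth p2)
  moreover have "p2 ^ d = p2 * p2 ^ (d - 1)" "p3 ^ d = p3 * p3 ^ (d - 1)"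
    using d by (metis Suc_diff_1 Suc_1 less_le_trans power_Suc zero_less_Suc)+
  ultimately show 1: "q $ 1 * p3 = p2 * t"
    using p2(2) by (simp add: t_def field_simps)
  have nth: "(?r * q * fps_deriv (fps_deriv q)) $ i
      = (fps_const (m - 1) * fps_deriv q * (q - ?r * fps_deriv q)) $ i" for i
    unfolding m_def using ode(2) by simp
  have rn: "?r $ 0 = p3" "?r $ 1 = 1" "?r $ 2 = 0" by simp_all
  have d1: "fps_deriv q $ 0 = q $ 1" "fps_deriv q $ 1 = 2 * q $ 2" "fps_deriv q $ 2 = 3 * q $ 3"
    by (simp_all add: eval_nat_numeral)
  have d2: "fps_deriv (fps_deriv q) $ 0 = 2 * q $ 2" "fps_deriv (fps_deriv q) $ 1 = 6 * q $ 3"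
    "fps_deriv (fps_deriv q) $ 2 = 12 * q $ 4"
    by (simp_all add: eval_nat_numeral)
  note expand = fps_mult_nth_upto_4 rn d1 d2 p2(1) fps_sub_nth
  have c: "fps_const (m - 1) $ 0 = m - 1" "fps_const (m - 1) $ 1 = 0" "fps_const (m - 1) $ 2 = 0"
    by simp_all
  have n0: "p3 * p2 * (2 * q $ 2) = (m - 1) * q $ 1 * (p2 - p3 * q $ 1)"
    using nth[of 0] unfolding expand c by simp
  have n1: "p3 * (6 * p2 * q $ 3 + 2 * q $ 1 * q $ 2) + 2 * p2 * q $ 2
      = (m - 1) * (q $ 1 * (- 2 * p3 * q $ 2) + 2 * q $ 2 * (p2 - p3 * q $ 1))"
    using nth[of 1] unfolding expand c by (simp add: algebra_simps)
  have n2: "p3 * (12 * p2 * q $ 4 + 6 * q $ 1 * q $ 3 + 2 * (q $ 2) ^ 2) + (6 * p2 * q $ 3 + 2 * q $ 1 * q $ 2)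
      = (m - 1) * (q $ 1 * (- q $ 2 - 3 * p3 * q $ 3) + 2 * q $ 2 * (- 2 * p3 * q $ 2)
          + 3 * q $ 3 * (p2 - p3 * q $ 1))"
    using nth[of 2] unfolding expand c by (simp add: algebra_simps power2_eq_square)
  \<comment> \<open>With these weights, multiplying the equation of index \<open>i\<close> by
    \<open>p3 ^ (i + 1)\<close> makes \<open>p3\<close> disappear.\<close>
  define u1 u2 u3 u4 where "u1 = q $ 1 * p3" and "u2 = q $ 2 * p3 ^ 2"
    and "u3 = q $ 3 * p3 ^ 3" and "u4 = q $ 4 * p3 ^ 4"
  note u = u1_def u2_def u3_def u4_def
  have m0: "2 * p2 * u2 = (m - 1) * u1 * (p2 - u1)"
    using arg_cong[OF n0, of "\<lambda>w. p3 * w"] by (simp add: u algebra_simps eval_nat_numeral)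
  have m1: "6 * p2 * u3 + 2 * u1 * u2 + 2 * p2 * u2 = (m - 1) * (2 * u2 * (p2 - u1) - 2 * u1 * u2)"
    using arg_cong[OF n1, of "\<lambda>w. p3 ^ 2 * w"] by (simp add: u algebra_simps eval_nat_numeral)
  have m2: "12 * p2 * u4 + 6 * u1 * u3 + 2 * u2 ^ 2 + 6 * p2 * u3 + 2 * u1 * u2
      = (m - 1) * (3 * u3 * (p2 - u1) - u1 * u2 - 3 * u1 * u3 - 4 * u2 ^ 2)"
    using arg_cong[OF n2, of "\<lambda>w. p3 ^ 3 * w"] by (simp add: u algebra_simps eval_nat_numeral)
  have u1: "u1 = p2 * t" using 1 by (simp add: u)
  have "(2 * p2) * u2 = (2 * p2) * (p2 * taylor2 m t)"
    unfolding m0 u1 taylor2_def by (simp add: algebra_simps)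
  then have u2: "u2 = p2 * taylor2 m t" using p2(2) by simp
  have "(6 * p2) * u3 = (m - 1) * (2 * u2 * (p2 - u1) - 2 * u1 * u2) - 2 * u1 * u2 - 2 * p2 * u2"
    using m1 by (simp add: algebra_simps)
  also have "\<dots> = (6 * p2) * (p2 * taylor3 m t)"
    unfolding u1 u2 taylor3_def by (simp add: algebra_simps)
  finally have u3: "u3 = p2 * taylor3 m t" using p2(2) by simp
  have "(12 * p2) * u4 = (m - 1) * (3 * u3 * (p2 - u1) - u1 * u2 - 3 * u1 * u3 - 4 * u2 ^ 2)
      - 6 * u1 * u3 - 2 * u2 ^ 2 - 6 * p2 * u3 - 2 * u1 * u2"
    using m2 by (simp add: algebra_simps)
  also have "\<dots> = (12 * p2) * (p2 * taylor4 m t)"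
    unfolding u1 u2 u3 taylor4_def by (simp add: algebra_simps power2_eq_square)
  finally have u4: "u4 = p2 * taylor4 m t" using p2(2) by simp
  show "q $ 2 * p3 ^ 2 = p2 * taylor2 m t"
    "q $ 3 * p3 ^ 3 = p2 * taylor3 m t" "q $ 4 * p3 ^ 4 = p2 * taylor4 m t"
    using u2 u3 u4 by (simp_all add: u2_def u3_def u4_def)
qed

lemma fquad_nth:
  fixes q :: "complex fps" and p1 p3 :: complex
  defines "y \<equiv> \<lambda>i. q $ i" and "D \<equiv> fquad (fps_const p1) q (fps_const p3 + fps_X)"
  shows "D a b c e f g $ 0 = a * p1 ^ 2 + b * y 0 ^ 2 + c * p3 ^ 2 + e * p1 * y 0 + f * p1 * p3 + g * y 0 * p3"
    "D a b c e f g $ 1 = 2 * b * y 0 * y 1 + 2 * c * p3 + e * p1 * y 1 + f * p1 + g * (y 0 + y 1 * p3)"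
    "D a b c e f g $ 2 = b * (2 * y 0 * y 2 + y 1 ^ 2) + c + e * p1 * y 2 + g * (y 1 + y 2 * p3)"
    "D a b c e f g $ 3 = b * (2 * y 0 * y 3 + 2 * y 1 * y 2) + e * p1 * y 3 + g * (y 2 + y 3 * p3)"
    "D a b c e f g $ 4 = b * (2 * y 0 * y 4 + 2 * y 1 * y 3 + y 2 ^ 2) + e * p1 * y 4 + g * (y 3 + y 4 * p3)"
proof -
  let ?r = "fps_const p3 + fps_X"
  have r: "?r $ 0 = p3" "?r $ 1 = 1" "?r $ 2 = 0" "?r $ 3 = 0" "?r $ 4 = 0" by simp_all
  have c: "fps_const k $ 0 = k" "fps_const k $ 1 = 0" "fps_const k $ 2 = 0" "fps_const k $ 3 = 0"
    "fps_const k $ 4 = 0" for k :: complex by simp_all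
  note expand = D_def fquad_def power2_eq_square fps_add_nth fps_mult_nth_upto_4 r[unfolded fps_add_nth] c y_def
  show "D a b c e f g $ 0 = a * p1 ^ 2 + b * y 0 ^ 2 + c * p3 ^ 2 + e * p1 * y 0 + f * p1 * p3 + g * y 0 * p3"
    "D a b c e f g $ 1 = 2 * b * y 0 * y 1 + 2 * c * p3 + e * p1 * y 1 + f * p1 + g * (y 0 + y 1 * p3)"
    "D a b c e f g $ 2 = b * (2 * y 0 * y 2 + y 1 ^ 2) + c + e * p1 * y 2 + g * (y 1 + y 2 * p3)"
    "D a b c e f g $ 3 = b * (2 * y 0 * y 3 + 2 * y 1 * y 2) + e * p1 * y 3 + g * (y 2 + y 3 * p3)"
    "D a b c e f g $ 4 = b * (2 * y 0 * y 4 + 2 * y 1 * y 3 + y 2 ^ 2) + e * p1 * y 4 + g * (y 3 + y 4 * p3)"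
    unfolding expand by (simp_all add: algebra_simps)
qed

text \<open>The factor \<open>p ^ 2\<close> completes all exponents to multiples of
  \<open>d\<close>, so the Fermat equation can be applied.\<close>

lemma osc_square_scaled:
  assumes "d > 0"
  shows "osc_square d p q r * p ^ 2 = (p ^ d) ^ 2 * (of_nat d + 1) *
     ((2 * of_nat d - 1) * q ^ d * r ^ d + (2 - of_nat d) * (q ^ d + r ^ d) * p ^ d)"
proof -
  have "p ^ (2 * d - 2) * p ^ 2 = (p ^ d) ^ 2"
    using assms by (cases d) (simp_all add: power_mult power2_eq_square power_mult_distrib)
  note this[symmetric]
  then show ?thesis unfolding osc_square_def by (simp only: mult_ac)
qed

lemma osc_mixed_scaled:
  assumes "d > 0"
  shows "osc_mixed d p q r * (p * q) =
    - (2 * (of_nat d + 1) * (of_nat d - 2) * (p ^ d) ^ 2 * (q ^ d) ^ 2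
     + 4 * (2 * of_nat d - 1) * (of_nat d - 2)
       * (p ^ d * (q ^ d) ^ 2 + (p ^ d) ^ 2 * q ^ d) * r ^ d)"
proof -
  have "p ^ (2 * d - 1) * p = (p ^ d) ^ 2" "p ^ (d - 1) * p = p ^ d" for p :: complex
    using assms by (cases d; simp add: power_mult power2_eq_square power_mult_distrib)+
  note pow = this
  have "- (u * P1 * Q1 + v * (P0 * Q1 + P1 * Q0) * R) * (p * q)
      = - (u * P2 * Q2 + v * (P * Q2 + P2 * Q) * R)"
    if "P1 * p = P2" "P0 * p = P" "Q1 * q = Q2" "Q0 * q = Q" for u v P P0 P1 P2 Q Q0 Q1 Q2 R :: complex
    unfolding that[symmetric] by (simp add: algebra_simps)
  then show ?thesis unfolding osc_mixed_def using pow by blast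
qed

lemma osculating_order:
  fixes q :: "complex fps"
  assumes d: "d \<ge> 2" and p2: "q $ 0 = p2" "p2 \<noteq> 0" and p3: "p3 \<noteq> 0"
    and eq: "fps_const p1 ^ d + q ^ d + (fps_const p3 + fps_X) ^ d = 0" and i: "i < 5"
  shows "fquad (fps_const p1) q (fps_const p3 + fps_X) (osc_square d p1 p2 p3)
     (osc_square d p2 p3 p1) (osc_square d p3 p1 p2) (osc_mixed d p1 p2 p3) (osc_mixed d p1 p3 p2)
     (osc_mixed d p2 p3 p1) $ i = 0"
proof -
  define t m B where "t = - (p3 ^ d / p2 ^ d)" and "m = (of_nat d :: complex)" and "B = p2 ^ d"
  note T = fermat_taylor[OF d p2 p3 eq, folded t_def m_def]
  have B: "p2 ^ d = B" by (simp add: B_def)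
  have A: "p3 ^ d = - t * B" using p2 by (simp add: t_def B_def)
  have "(fps_const p1 ^ d + q ^ d + (fps_const p3 + fps_X) ^ d) $ 0 = 0" unfolding eq by simp
  then have "p1 ^ d + B + p3 ^ d = 0" by (simp add: fps_power_zeroth p2 B_def)
  moreover have "w = (t - 1) * B" if "w + B + - t * B = 0" for w
    using that by algebra
  ultimately have C: "p1 ^ d = (t - 1) * B" unfolding A by blast
  define a b c e f g where "a = osc_square d p1 p2 p3" and "b = osc_square d p2 p3 p1"
    and "c = osc_square d p3 p1 p2" and "e = osc_mixed d p1 p2 p3" and "f = osc_mixed d p1 p3 p2"
    and "g = osc_mixed d p2 p3 p1"
  have d0: "d > 0" using d by simp
  note sq = osc_square_scaled[OF d0, folded m_def] and mx = osc_mixed_scaled[OF d0, folded m_def]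
  \<comment> \<open>The scaled coefficients have degree 4 in the \<open>d\<close>-th powers, whence
    the common factor \<open>B ^ 4\<close>; what remains depends on \<open>t\<close> and
    \<open>m\<close> only.\<close>
  have a: "a * p1 ^ 2 = B ^ 4 * ((t - 1) ^ 2 * (m + 1) * ((2 * m - 1) * (- t) + (2 - m) * (1 - t) * (t - 1)))"
    unfolding a_def sq A B C by algebra
  have b: "b * p2 ^ 2 = B ^ 4 * ((m + 1) * ((2 * m - 1) * t * (1 - t) + (m - 2)))"
    unfolding b_def sq A B C by algebra
  have c: "c * p3 ^ 2 = B ^ 4 * (t ^ 2 * (m + 1) * ((2 * m - 1) * (t - 1) - (2 - m) * t ^ 2))"
    unfolding c_def sq A B C by algebra
  have e: "e * (p1 * p2) = B ^ 4 * (- (2 * (m + 1) * (m - 2) * (t - 1) ^ 2 - 4 * (2 * m - 1) * (m - 2) * t ^ 2 * (t - 1)))"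
    unfolding e_def mx A B C by algebra
  have f: "f * (p1 * p3) = B ^ 4 * (- (2 * (m + 1) * (m - 2) * (t - 1) ^ 2 * t ^ 2 + 4 * (2 * m - 1) * (m - 2) * t * (t - 1)))"
    unfolding f_def mx A B C by algebra
  have g: "g * (p2 * p3) = B ^ 4 * (- (2 * (m + 1) * (m - 2) * t ^ 2 + 4 * (2 * m - 1) * (m - 2) * t * (t - 1) ^ 2))"
    unfolding g_def mx A B C by algebra
  let ?D = "fquad (fps_const p1) q (fps_const p3 + fps_X) a b c e f g"
  note D = fquad_nth[of p1 q p3 a b c e f g]
  have "?D $ 0 = a * p1 ^ 2 + b * p2 ^ 2 + c * p3 ^ 2 + e * (p1 * p2) + f * (p1 * p3) + g * (p2 * p3)"
    unfolding D p2(1) by (simp add: algebra_simps)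
  also have "\<dots> = 0"
    unfolding a b c e f g by (simp add: algebra_simps eval_nat_numeral)
  finally have 0: "?D $ 0 = 0" .
  \<comment> \<open>The power of \<open>p3\<close> is distributed so that only scaled coefficients
    and scaled Taylor coefficients remain; the same is done at each later index.\<close>
  have "?D $ 1 * p3 = 2 * b * p2 * (q $ 1 * p3) + 2 * (c * p3 ^ 2) + e * p1 * (q $ 1 * p3)
      + f * (p1 * p3) + g * p3 * (p2 + q $ 1 * p3)"
    unfolding D p2(1) by (simp add: algebra_simps eval_nat_numeral)
  also have "\<dots> = 2 * (b * p2 ^ 2) * t + 2 * (c * p3 ^ 2) + (e * (p1 * p2)) * t
      + f * (p1 * p3) + (g * (p2 * p3)) * (1 + t)"
    unfolding T by (simp add: algebra_simps power2_eq_square)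
  also have "\<dots> = 0"
    unfolding a b c e f g by (simp add: algebra_simps eval_nat_numeral)
  finally have 1: "?D $ 1 = 0" using p3 by simp
  have "?D $ 2 * p3 ^ 2 = b * (2 * p2 * (q $ 2 * p3 ^ 2) + (q $ 1 * p3) ^ 2) + c * p3 ^ 2
      + e * p1 * (q $ 2 * p3 ^ 2) + g * p3 * (q $ 1 * p3 + q $ 2 * p3 ^ 2)"
    unfolding D p2(1) by (simp add: algebra_simps eval_nat_numeral)
  also have "\<dots> = (b * p2 ^ 2) * (2 * taylor2 m t + t ^ 2) + c * p3 ^ 2
      + (e * (p1 * p2)) * taylor2 m t + (g * (p2 * p3)) * (t + taylor2 m t)"
    unfolding T by (simp add: algebra_simps power2_eq_square)
  also have "\<dots> = 0"
    unfolding b c e g taylor2_def by (simp add: field_simps eval_nat_numeral)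
  finally have 2: "?D $ 2 = 0" using p3 by simp
  have "?D $ 3 * p3 ^ 3 = b * (2 * p2 * (q $ 3 * p3 ^ 3) + 2 * (q $ 1 * p3) * (q $ 2 * p3 ^ 2))
      + e * p1 * (q $ 3 * p3 ^ 3) + g * p3 * (q $ 2 * p3 ^ 2 + q $ 3 * p3 ^ 3)"
    unfolding D p2(1) by (simp add: algebra_simps eval_nat_numeral)
  also have "\<dots> = (b * p2 ^ 2) * (2 * taylor3 m t + 2 * t * taylor2 m t)
      + (e * (p1 * p2)) * taylor3 m t + (g * (p2 * p3)) * (taylor2 m t + taylor3 m t)"
    unfolding T by (simp add: algebra_simps power2_eq_square)
  also have "\<dots> = 0"
    unfolding b e g taylor3_def taylor2_def by (simp add: field_simps eval_nat_numeral)
  finally have 3: "?D $ 3 = 0" using p3 by simp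
  have "?D $ 4 * p3 ^ 4 = b * (2 * p2 * (q $ 4 * p3 ^ 4) + 2 * (q $ 1 * p3) * (q $ 3 * p3 ^ 3) + (q $ 2 * p3 ^ 2) ^ 2)
      + e * p1 * (q $ 4 * p3 ^ 4) + g * p3 * (q $ 3 * p3 ^ 3 + q $ 4 * p3 ^ 4)"
    unfolding D p2(1) by (simp add: algebra_simps eval_nat_numeral)
  also have "\<dots> = (b * p2 ^ 2) * (2 * taylor4 m t + 2 * t * taylor3 m t + taylor2 m t ^ 2)
      + (e * (p1 * p2)) * taylor4 m t + (g * (p2 * p3)) * (taylor3 m t + taylor4 m t)"
    unfolding T by (simp add: algebra_simps power2_eq_square)
  also have "\<dots> = 0"
    unfolding b e g taylor4_def taylor3_def taylor2_def by (simp add: field_simps eval_nat_numeral)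
  finally have 4: "?D $ 4 = 0" using p3 by simp
  have "i = 0 \<or> i = 1 \<or> i = 2 \<or> i = 3 \<or> i = 4" using i by linarith
  then show ?thesis
    using 0 1 2 3 4 unfolding a_def b_def c_def e_def f_def g_def by blast
qed

text \<open>The condition \<open>normal\<close> is the vanishing at \<open>p\<close> of the
  derivative in the second variable. It is the factor of \<open>q $ 3\<close> and
  \<open>q $ 4\<close> in the conditions of index 3 and 4, which thereby become triangular in
  \<open>g\<close> and \<open>b\<close>.\<close>

lemma nonflex_fquad_zero:
  fixes q :: "complex fps"
  assumes d: "d \<ge> 2" and p2: "q $ 0 = p2" and nz: "p1 \<noteq> 0" "p2 \<noteq> 0" "p3 \<noteq> 0"
    and eq: "fps_const p1 ^ d + q ^ d + (fps_const p3 + fps_X) ^ d = 0"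
    and zero: "\<forall>i<5. fquad (fps_const p1) q (fps_const p3 + fps_X) a b c e f g $ i = 0"
    and normal: "2 * b * p2 + e * p1 + g * p3 = 0"
  shows "a = 0 \<and> b = 0 \<and> c = 0 \<and> e = 0 \<and> f = 0 \<and> g = 0"
proof -
  define t m where "t = - (p3 ^ d / p2 ^ d)" and "m = (of_nat d :: complex)"
  note T = fermat_taylor[OF d p2 nz(2,3) eq, folded t_def m_def]
  have "(fps_const p1 ^ d + q ^ d + (fps_const p3 + fps_X) ^ d) $ 0 = 0" unfolding eq by simp
  then have "p1 ^ d + p2 ^ d + p3 ^ d = 0" by (simp add: fps_power_zeroth p2)
  moreover have "p3 ^ d = - t * p2 ^ d" using nz by (simp add: t_def)
  moreover have "w = (t - 1) * B" if "w + B + A = 0" "A = - t * B" for w A B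
    using that by algebra
  ultimately have "p1 ^ d = (t - 1) * p2 ^ d" by blast
  \<comment> \<open>These are the nonvanishing of \<open>p1\<close> and \<open>p3\<close>; they make
    the second Taylor coefficient nonzero, so \<open>p\<close> is not a flex.\<close>
  then have "t \<noteq> 1" "t \<noteq> 0" using nz by (auto simp: t_def)
  moreover have "m \<noteq> 1" using d by (auto simp: m_def)
  ultimately have "taylor2 m t \<noteq> 0" by (simp add: taylor2_def)
  then have y2: "q $ 2 \<noteq> 0" using T(2) nz by auto
  define y1 y2 y3 y4 where "y1 = q $ 1" and "y2 = q $ 2" and "y3 = q $ 3" and "y4 = q $ 4"
  note D = fquad_nth[of p1 q p3 a b c e f g, folded y1_def y2_def y3_def y4_def, unfolded p2]
  note z = zero[rule_format, of 0] zero[rule_format, of 1] zero[rule_format, of 2]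
    zero[rule_format, of 3] zero[rule_format, of 4]
  have "y2 * (2 * b * y1 + g) = 0"
    using z(4) normal unfolding D by simp algebra
  then have g: "g = - 2 * b * y1"
    using \<open>q $ 2 \<noteq> 0\<close> by (simp add: y2_def add_eq_0_iff)
  \<comment> \<open>\<open>normal\<close> removes \<open>y4\<close>, and the value of
    \<open>g\<close> cancels the terms in \<open>y3\<close>.\<close>
  have "b * y2 ^ 2 = 0"
    using z(5) normal g unfolding D by simp algebra
  then have b: "b = 0" using \<open>q $ 2 \<noteq> 0\<close> by (simp add: y2_def)
  with g normal nz have e: "g = 0" "e = 0" by auto
  have c: "c = 0" using z(3) unfolding D by (simp add: b e)
  have f: "f = 0" using z(2) nz unfolding D by (simp add: b e c)
  have "a = 0" using z(1) nz unfolding D by (simp add: b e c f)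
  with b c e f show ?thesis by simp
qed

text \<open>One square and one mixed coefficient suffice: with \<open>C + B = - A\<close>, their
  vanishing gives two linear equations for \<open>C * B\<close> in terms of \<open>A ^ 2\<close>,
  which are incompatible.\<close>

lemma osculating_nonzero:
  assumes d: "d \<ge> 3" and nz: "p1 \<noteq> 0" "p2 \<noteq> 0" "p3 \<noteq> 0" and eq: "p1 ^ d + p2 ^ d + p3 ^ d = 0"
  shows "osc_square d p3 p1 p2 \<noteq> 0 \<or> osc_mixed d p1 p2 p3 \<noteq> 0"
proof (rule ccontr)
  assume *: "\<not> ?thesis"
  define m A B C where "m = (of_nat d :: complex)" and "A = p3 ^ d" and "B = p2 ^ d" and "C = p1 ^ d"
  have ABC: "C + B = - A" "A \<noteq> 0" "B \<noteq> 0" "C \<noteq> 0"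
    using eq nz by (simp_all add: A_def B_def C_def eq_neg_iff_add_eq_0)
  have d0: "d > 0" using d by simp
  have "m + 1 = of_nat (d + 1)" "m - 2 = of_nat (d - 2)"
    using d by (simp_all add: m_def of_nat_diff)
  then have m: "m + 1 \<noteq> 0" "m - 2 \<noteq> 0"
    using d by (simp_all only: of_nat_eq_0_iff)
  have "A ^ 2 * (m + 1) * ((2 * m - 1) * C * B + (2 - m) * (C + B) * A) = 0"
    using osc_square_scaled[OF d0, of p3 p1 p2] * by (simp add: A_def B_def C_def m_def)
  then have "(2 * m - 1) * C * B + (2 - m) * (C + B) * A = 0"
    using m ABC(2) by simp
  then have 1: "(2 * m - 1) * (C * B) = - (m - 2) * A ^ 2"
    using ABC(1) by algebra
  have "2 * (m + 1) * (m - 2) * C ^ 2 * B ^ 2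
      + 4 * (2 * m - 1) * (m - 2) * (C * B ^ 2 + C ^ 2 * B) * A = 0"
    using osc_mixed_scaled[OF d0, of p1 p2 p3] * unfolding A_def B_def C_def m_def
    by (metis mult_zero_left neg_equal_0_iff_equal)
  moreover have "2 * (m + 1) * (m - 2) * C ^ 2 * B ^ 2
      + 4 * (2 * m - 1) * (m - 2) * (C * B ^ 2 + C ^ 2 * B) * A
      = 2 * (m - 2) * C * B * ((m + 1) * (C * B) + 2 * (2 * m - 1) * (C + B) * A)"
    by (simp add: algebra_simps power2_eq_square)
  ultimately have "(m + 1) * (C * B) + 2 * (2 * m - 1) * (C + B) * A = 0"
    using m ABC(3,4) by simp
  then have 2: "(m + 1) * (C * B) = 2 * (2 * m - 1) * A ^ 2"
    using ABC(1) by algebra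
  \<comment> \<open>Eliminating \<open>C * B\<close> leaves
    \<open>2 * (2 * m - 1) ^ 2 + (m + 1) * (m - 2) = 9 * m * (m - 1)\<close>.\<close>
  have "(9 * m * (m - 1)) * A ^ 2 = 0"
    using 1 2 by algebra
  moreover have "m \<noteq> 0" "m \<noteq> 1" using d by (auto simp: m_def)
  ultimately show False using ABC by simp
qed

section \<open>The osculating conic\<close>

lemma flex_case:
  assumes d: "d \<ge> 3" and cyc: "cyclic_vars X Y Z" and F0: "eval3 (fermat_curve d) p = 0"
    and nz: "eval3 X p \<noteq> 0" "eval3 Y p \<noteq> 0" and flex: "eval3 Z p = 0"
  shows "(d = 3 \<longrightarrow> is_osculating_conic d p (osculating_poly d p)) \<and>
    is_hyperosculating_conic d p (osculating_poly d p)"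
proof -
  obtain px py pz where p: "p = (px, py, pz)" by (cases p)
  define p1 p2 where "p1 = eval3 X p" and "p2 = eval3 Y p"
  have nz': "p1 \<noteq> 0" "p2 \<noteq> 0" using nz by (simp_all add: p1_def p2_def)
  have d0: "d > 0" using d by simp
  obtain x y z q where br: "branch px py pz x y z (fermat_curve d) X (cst p1 * Z - cst 0 * X) d"
    and E: "ev fps_const x y z X = fps_const p1" "ev fps_const x y z Y = q"
      "ev fps_const x y z Z = fps_const 0 + fps_X"
    and q: "q $ 0 = p2" "fps_const p1 ^ d + q ^ d + (fps_const 0 + fps_X) ^ d = 0"
    using fermat_arc[OF d0 cyc F0[unfolded p] nz[unfolded p], unfolded flex[unfolded p]]
    unfolding p1_def p2_def p by blast
  interpret branch px py pz x y z "(px, py, pz)" "ev fps_const x y z" "fermat_curve d" X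
    "cst p1 * Z - cst 0 * X" d
    using br by simp_all
  have q': "fps_const p1 ^ d + q ^ d + fps_X ^ d = 0" using q(2) by simp
  have "(fps_const p1 ^ d + q ^ d + fps_X ^ d) $ 0 = 0" unfolding q' by simp
  then have C: "p1 ^ d = - (p2 ^ d)"
    using d0 by (simp add: fps_power_zeroth q zero_power add_eq_0_iff2)
  define a b e where "a = osc_square d p1 p2 0" and "b = osc_square d p2 0 p1"
    and "e = osc_mixed d p1 p2 0"
  \<comment> \<open>The coefficients of \<open>Z ^ 2\<close>, \<open>X * Z\<close> and
    \<open>Y * Z\<close> contain a positive power of the vanishing coordinate.\<close>
  have K: "osculating_poly d p = quad X Y Z a b 0 e 0 0"
    unfolding osculating_poly_quad[OF cyc] Let_def flex p1_def[symmetric] p2_def[symmetric]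
    using d by (simp add: a_def b_def e_def osc_square_def osc_mixed_def zero_power)
  have m: "of_nat d + 1 \<noteq> (0 :: complex)" "2 - of_nat d \<noteq> (0 :: complex)"
  proof -
    have "of_nat d + 1 = (of_nat (d + 1) :: complex)" "2 - of_nat d = - (of_nat (d - 2) :: complex)"
      using d by (simp_all add: of_nat_diff)
    then show "of_nat d + 1 \<noteq> (0 :: complex)" "2 - of_nat d \<noteq> (0 :: complex)"
      using d by (simp_all only: of_nat_eq_0_iff neg_equal_0_iff_equal)
  qed
  then have b: "b \<noteq> 0"
    using nz' d by (simp add: b_def osc_square_def zero_power)
  have a: "a * p1 ^ 2 = b * p2 ^ 2"
    unfolding a_def b_def osc_square_scaled[OF d0] C using d0
    by (simp add: zero_power power2_eq_square)
  have "(e * p1) * p2 = (- 2 * b * p2) * p2"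
  proof -
    have "e * (p1 * p2) = - 2 * (b * p2 ^ 2)"
      unfolding e_def b_def osc_square_scaled[OF d0] osc_mixed_scaled[OF d0] C using d0
      by (simp add: zero_power power2_eq_square algebra_simps)
    then show ?thesis by (simp add: power2_eq_square mult.assoc)
  qed
  then have e: "e * p1 = - 2 * b * p2" using nz'(2) by (metis mult_right_cancel)
  have "\<forall>i<2 * d. ev fps_const x y z (osculating_poly d p) $ i = 0"
    using flex_fquad_order[OF d nz' q(1) q' e a] by (simp add: K E_quad E)
  moreover have "is_conic (osculating_poly d p)"
    using b by (simp add: is_conic_def K homogeneous_quad[OF cyc] quad_eq_0[OF cyc])
  moreover have "same_curve (osculating_poly d p) D"
    if D: "is_conic D" "\<forall>i<d + 2. ev fps_const x y z D $ i = 0" for D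
  proof -
    obtain a' b' c' e' f' g' where D': "D = quad X Y Z a' b' c' e' f' g'"
      using D(1) homogeneous_2_quad[OF _ cyc] unfolding is_conic_def by blast
    have "\<forall>i<d + 2. fquad (fps_const p1) q fps_X a' b' c' e' f' g' $ i = 0"
      using D(2) by (simp add: D' E_quad E)
    then have *: "c' = 0 \<and> f' = 0 \<and> g' = 0 \<and> e' * p1 = - 2 * b' * p2 \<and> a' * p1 ^ 2 = b' * p2 ^ 2"
      by (rule flex_fquad_zero[OF d nz' q(1) q'])
    \<comment> \<open>On the line of multiples of the squared tangent, the coefficient of
      \<open>Y ^ 2\<close> determines the conic.\<close>
    define k where "k = b' / b"
    have k: "b' = k * b" using b by (simp add: k_def)
    have "e' * p1 = (k * e) * p1"
      using * k unfolding mult.assoc[of k] e by simp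
    moreover have "a' * p1 ^ 2 = (k * a) * p1 ^ 2"
      using * k unfolding mult.assoc[of k] a by simp
    ultimately have "e' = k * e" "a' = k * a" using nz'(1) by simp_all
    then have "D = cst k * osculating_poly d p"
      using * k by (simp add: D' K cst_mult_quad)
    moreover have "k \<noteq> 0"
      using D(1) calculation by (auto simp: is_conic_def cst_hom)
    ultimately show ?thesis unfolding same_curve_def by blast
  qed
  ultimately show ?thesis
    unfolding p by (intro hyperosculating_cases[OF d refl])
qed

lemma nonflex_case:
  assumes d: "d \<ge> 3" and F0: "eval3 (fermat_curve d) (px, py, pz) = 0"
    and nz: "px \<noteq> 0" "py \<noteq> 0" "pz \<noteq> 0"
  shows "is_osculating_conic d (px, py, pz) (osculating_poly d (px, py, pz))"
proof -
  have d0: "d > 0" and d2: "d \<ge> 2" using d by simp_all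
  have cyc: "cyclic_vars xvar yvar zvar" by (simp add: cyclic_vars_def)
  obtain x y z q where
    br: "branch px py pz x y z (fermat_curve d) xvar (cst px * zvar - cst pz * xvar) d"
    and E: "ev fps_const x y z xvar = fps_const px" "ev fps_const x y z yvar = q"
      "ev fps_const x y z zvar = fps_const pz + fps_X"
    and q: "q $ 0 = py" "fps_const px ^ d + q ^ d + (fps_const pz + fps_X) ^ d = 0"
    using fermat_arc[OF d0 cyc F0, unfolded eval3_simps, OF nz(1,2)] by blast
  interpret branch px py pz x y z "(px, py, pz)" "ev fps_const x y z" "fermat_curve d" xvar
    "cst px * zvar - cst pz * xvar" d
    using br by simp_all
  let ?p = "(px, py, pz)"
  define K where "K = osculating_poly d ?p"
  define a b c e f g where "a = osc_square d px py pz" and "b = osc_square d py pz px"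
    and "c = osc_square d pz px py" and "e = osc_mixed d px py pz" and "f = osc_mixed d px pz py"
    and "g = osc_mixed d py pz px"
  have K: "K = quad xvar yvar zvar a b c e f g"
    unfolding K_def osculating_poly_quad[OF cyc]
    by (simp add: a_def b_def c_def e_def f_def g_def)
  have ord: "\<forall>i<5. fquad (fps_const px) q (fps_const pz + fps_X) a b c e f g $ i = 0"
    unfolding a_def b_def c_def e_def f_def g_def
    using osculating_order[OF d2 q(1) nz(2,3) q(2)] by blast
  have "enat 5 \<le> intersection_mult ?p K (fermat_curve d)"
    using ord by (intro intersection_mult_ge) (simp only: K E_quad E)
  moreover have EQ5: "enat 5 = 5" by (simp add: numeral_eq_enat)
  moreover have "px ^ d + py ^ d + pz ^ d = 0"
    using F0 by (simp add: fermat_curve_def eval3_hom)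
  then have nonzero: "c \<noteq> 0 \<or> e \<noteq> 0"
    unfolding c_def e_def using osculating_nonzero[OF d nz] by blast
  then have "is_conic K"
    by (auto simp: is_conic_def K homogeneous_quad[OF cyc] quad_eq_0[OF cyc])
  moreover have "same_curve K D"
    if D: "is_conic D" "5 \<le> intersection_mult ?p D (fermat_curve d)" for D
  proof -
    obtain a' b' c' e' f' g' where D': "D = quad xvar yvar zvar a' b' c' e' f' g'"
      using D(1) homogeneous_2_quad[OF _ cyc] unfolding is_conic_def by blast
    have "\<forall>i<5. ev fps_const x y z D $ i = 0"
      using E_nth_eq_0[of 2 D 5] D by (auto simp: is_conic_def EQ5)
    then have ord': "\<forall>i<5. fquad (fps_const px) q (fps_const pz + fps_X) a' b' c' e' f' g' $ i = 0"
      by (simp only: D' E_quad E)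
    define l where "l = 2 * b * py + e * px + g * pz"
    \<comment> \<open>Chosen so that \<open>D - k * K\<close> also satisfies the sixth condition and
      therefore vanishes.\<close>
    define k where "k = (2 * b' * py + e' * px + g' * pz) / l"
    \<comment> \<open>Otherwise \<open>K\<close> itself would satisfy all six conditions and be
      zero.\<close>
    have l: "l \<noteq> 0"
      using nonflex_fquad_zero[OF d2 q(1) nz q(2) ord] nonzero by (auto simp: l_def)
    have "fquad (fps_const px) q (fps_const pz + fps_X)
        (a' - k * a) (b' - k * b) (c' - k * c) (e' - k * e) (f' - k * f) (g' - k * g)
      = fquad (fps_const px) q (fps_const pz + fps_X) a' b' c' e' f' g'
        - fps_const k * fquad (fps_const px) q (fps_const pz + fps_X) a b c e f g"
      unfolding fquad_def
      by (simp only: fps_const_sub[symmetric] fps_const_mult[symmetric]) (simp only: algebra_simps)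
    then have "\<forall>i<5. fquad (fps_const px) q (fps_const pz + fps_X)
        (a' - k * a) (b' - k * b) (c' - k * c) (e' - k * e) (f' - k * f) (g' - k * g) $ i = 0"
      using ord ord' by simp
    moreover have "2 * (b' - k * b) * py + (e' - k * e) * px + (g' - k * g) * pz = 0"
    proof -
      have "2 * b' * py + e' * px + g' * pz = k * l" using l by (simp add: k_def)
      then show ?thesis unfolding l_def by (simp add: algebra_simps)
    qed
    ultimately have "a' - k * a = 0 \<and> b' - k * b = 0 \<and> c' - k * c = 0 \<and> e' - k * e = 0
        \<and> f' - k * f = 0 \<and> g' - k * g = 0"
      by (rule nonflex_fquad_zero[OF d2 q(1) nz q(2)])
    then have "D = cst k * K"
      by (simp add: D' K cst_mult_quad)
    moreover have "k \<noteq> 0"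
      using D(1) calculation by (auto simp: is_conic_def cst_hom)
    ultimately show ?thesis unfolding same_curve_def by blast
  qed
  ultimately show ?thesis
    unfolding is_osculating_conic_def K_def by simp
qed

theorem lemma2p2:
  fixes d :: nat and px py pz :: complex
  assumes "d \<ge> 3"
    and "(px, py, pz) \<in> zero_set (fermat_curve d)"
  shows "(d = 3 \<or> px * py * pz \<noteq> 0 \<longrightarrow>
            is_osculating_conic d (px, py, pz) (osculating_poly d (px, py, pz))) \<and>
         (d \<ge> 4 \<and> px * py * pz = 0 \<longrightarrow>
            is_hyperosculating_conic d (px, py, pz) (osculating_poly d (px, py, pz)))"
proof (cases "px * py * pz = 0")
  case False
  with assms show ?thesis
    using nonflex_case[of d px py pz] by (auto simp: zero_set_def)
next
  case True
  have F0: "eval3 (fermat_curve d) (px, py, pz) = 0" and p: "(px, py, pz) \<noteq> (0, 0, 0)"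
    using assms by (auto simp: zero_set_def)
  have "px ^ d + py ^ d + pz ^ d = 0"
    using F0 by (simp add: fermat_curve_def eval3_hom)
  \<comment> \<open>Two vanishing coordinates would force the third to vanish, so exactly one is
    zero; a rotation makes it the last.\<close>
  then have "\<exists>X Y Z. cyclic_vars X Y Z \<and> eval3 X (px, py, pz) \<noteq> 0 \<and> eval3 Y (px, py, pz) \<noteq> 0 \<and>
      eval3 Z (px, py, pz) = 0"
    using True p assms(1) unfolding cyclic_vars_def
    by (cases "px = 0"; cases "py = 0"; cases "pz = 0") (force simp: zero_power)+
  then obtain X Y Z where "cyclic_vars X Y Z" "eval3 X (px, py, pz) \<noteq> 0"
    "eval3 Y (px, py, pz) \<noteq> 0" "eval3 Z (px, py, pz) = 0" by blast
  from flex_case[OF assms(1) this(1) F0 this(2-4)] True show ?thesis by auto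
qed

end
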